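(* Let $w:\mathbb R\to[0,\infty)$ be a loss function, that is, a monotone nondecreasing function satisfying $w(0)=0$ and $w\not\equiv0$. Let the integers $n,M,D$ be such that $2\le M\le n$, and let $X_1,\dots,X_n$ be distinct points of $\mathcal X$. Consider observations $Y_i=f(X_i)+W_i$, $i=1,\dots,n$, with $W_1,\dots,W_n$ independent $N(0,\sigma^2)$ random variables. Let $(H^M,\psi_{n,M})$ be one of the following: (C) $H^M=\Lambda^M$, with $\psi_{n,M}=M/n$ if $M\le\sqrt n$ and $\psi_{n,M}=\sqrt{\{\log(1+M/\sqrt n)\}/n}$ if $M>\sqrt n$; (MS) $H^M$ is the set of all vertices of $\Lambda^M$ except the vertex $(0,\dots,0)\in\mathbb R^M$, with $\psi_{n,M}=(\log M)/n$; (S) $H^M=\Lambda^{M,D}$, with $\psi_{n,M}=\{D\log(1+M/D)\}/n$, where it is assumed in addition that $M\log(M/D+1)\le n$ and $M\ge D\ge 1$. Then there exist $f_1,\dots,f_M\in\mathcal F_0$ such that $$\inf_{T_n}\sup_{f\in\mathcal F_0}\mathbb E_f\,w\left[\psi_{n,M}^{-1}\left(\|T_n-f\|_n^2-\inf_{\lambda\in H^M}\|\mathsf f_\lambda-f\|_n^2\right)\right]\ge c,$$ where $\inf_{T_n}$ denotes the infimum over all estimators and the constant $c>0$ does not depend on $n$, $M$ and $D$.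
   Context: $\mathcal X$ is a Borel subset of $\mathbb R^d$, and $\sigma^2>0$ and $0<L<\infty$ are fixed constants. $\mathcal F_0=\{g:\mathcal X\to\mathbb R:\ \sup_{x\in\mathcal X}|g(x)|\le L\}$. For a function $g$, $\|g\|_n=\{n^{-1}\sum_{i=1}^n g^2(X_i)\}^{1/2}$. For $\lambda=(\lambda_1,\dots,\lambda_M)\in\mathbb R^M$, $\mathsf f_\lambda=\sum_{j=1}^M\lambda_jf_j$. $\Lambda^M=\{\lambda\in\mathbb R^M:\lambda_j\ge0,\ \sum_{j=1}^M\lambda_j\le1\}$. $\Lambda^{M,D}$ is the set of all $\lambda\in\mathbb R^M$ having at most $D$ nonzero coordinates. An estimator $T_n$ is a function on $\mathcal X$ depending on the data $(X_1,Y_1),\dots,(X_n,Y_n)$. $\mathbb E_f$ denotes expectation under the model with regression function $f$.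
   Formalization: The loss is additionally assumed to satisfy w(t)>0 for all t>0; without this the claim fails, e.g. w the indicator of (A,∞) with A large, n=M=2, T_n=0, where the excess is at most L² and the risk is 0. *)

theory Defs
  imports "HOL-Probability.Probability" "HOL-Analysis.Finite_Function_Topology"
begin

text \<open>
  Vectors of \<open>R\<^sup>M\<close>, for a dimension \<open>M\<close> that varies inside the statement, are finitely supported
  functions \<open>nat \<Rightarrow>\<^sub>0 real\<close> whose keys (nonzero coordinates) lie in \<open>{1..M}\<close>.
\<close>

definition coeff_space :: "nat \<Rightarrow> (nat \<Rightarrow>\<^sub>0 real) set" where
  "coeff_space M = {v. Poly_Mapping.keys v \<subseteq> {1..M}}"

definition Lambda :: "nat \<Rightarrow> (nat \<Rightarrow>\<^sub>0 real) set" where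
  "Lambda M = {v \<in> coeff_space M.
     (\<forall>j\<in>{1..M}. 0 \<le> Poly_Mapping.lookup v j) \<and> (\<Sum>j=1..M. Poly_Mapping.lookup v j) \<le> 1}"

definition Lambda_sparse :: "nat \<Rightarrow> nat \<Rightarrow> (nat \<Rightarrow>\<^sub>0 real) set" where
  "Lambda_sparse M D = {v \<in> coeff_space M. card (Poly_Mapping.keys v) \<le> D}"

definition lin_comb :: "nat \<Rightarrow> (nat \<Rightarrow> 'a \<Rightarrow> real) \<Rightarrow> (nat \<Rightarrow>\<^sub>0 real) \<Rightarrow> 'a \<Rightarrow> real" where
  "lin_comb M f v x = (\<Sum>j=1..M. Poly_Mapping.lookup v j * f j x)"

text \<open>Membership depends only on the values on \<open>\<X>\<close>; so does everything below.\<close>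

definition F0 :: "'a set \<Rightarrow> real \<Rightarrow> ('a \<Rightarrow> real) set" where
  "F0 \<X> L = {g. \<forall>x\<in>\<X>. \<bar>g x\<bar> \<le> L}"

definition emp_norm :: "nat \<Rightarrow> (nat \<Rightarrow> 'a) \<Rightarrow> ('a \<Rightarrow> real) \<Rightarrow> real" where
  "emp_norm n X g = sqrt ((\<Sum>i=1..n. (g (X i))\<^sup>2) / real n)"

text \<open>
  A loss function may vanish on a right neighbourhood of \<open>0\<close>, as the indicator of \<open>{A<..}\<close> with
  \<open>A > 0\<close> does. For large \<open>A\<close> the minimax risk is then \<open>0\<close>, for example at \<open>n = M = 2\<close>: the
  estimator \<open>0\<close> always has excess at most \<open>L\<^sup>2\<close>. No positive lower bound uniform in \<open>n\<close>, \<open>M\<close>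
  and \<open>D\<close> holds for such a loss, so bounds of this kind also need \<open>w t > 0\<close> for all \<open>t > 0\<close>.
\<close>

definition loss_function :: "(real \<Rightarrow> real) \<Rightarrow> bool" where
  "loss_function w \<longleftrightarrow> mono w \<and> (\<forall>t. 0 \<le> w t) \<and> w 0 = 0 \<and> w \<noteq> (\<lambda>_. 0)"

text \<open>
  The joint law of \<open>n\<close> independent \<open>N(0, \<sigma>\<^sup>2)\<close> variables;
  the second parameter of \<^const>\<open>normal_density\<close> is the standard deviation.
\<close>

definition gaussian_noise :: "nat \<Rightarrow> real \<Rightarrow> (nat \<Rightarrow> real) measure" where
  "gaussian_noise n \<sigma> = (\<Pi>\<^sub>M i\<in>{1..n}. density lborel (\<lambda>x. ennreal (normal_density 0 \<sigma> x)))"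

definition sample :: "nat \<Rightarrow> (nat \<Rightarrow> 'a) \<Rightarrow> ('a \<Rightarrow> real) \<Rightarrow> (nat \<Rightarrow> real) \<Rightarrow> (nat \<Rightarrow> 'a \<times> real)" where
  "sample n X f W = (\<lambda>i\<in>{1..n}. (X i, f (X i) + W i))"

text \<open>
  The expectation \<open>E\<^sub>f\<close> of a nonnegative function of the data; it may be infinite.
\<close>

definition expect :: "nat \<Rightarrow> real \<Rightarrow> (nat \<Rightarrow> 'a) \<Rightarrow> ('a \<Rightarrow> real)
    \<Rightarrow> ((nat \<Rightarrow> 'a \<times> real) \<Rightarrow> real) \<Rightarrow> ennreal" where
  "expect n \<sigma> X f \<phi> = (\<integral>\<^sup>+ W. ennreal (\<phi> (sample n X f W)) \<partial>gaussian_noise n \<sigma>)"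

text \<open>
  An estimator maps the data to a function on \<open>\<X>\<close>. Only its value at each fixed point of \<open>\<X>\<close>
  has to be a measurable function of the data; no regularity in the point is required.
\<close>

definition estimators :: "nat \<Rightarrow> 'a::topological_space set
    \<Rightarrow> ((nat \<Rightarrow> 'a \<times> real) \<Rightarrow> 'a \<Rightarrow> real) set" where
  "estimators n \<X> = {T. \<forall>x\<in>\<X>. (\<lambda>z. T z x)
     \<in> borel_measurable (\<Pi>\<^sub>M i\<in>{1..n}. restrict_space borel \<X> \<Otimes>\<^sub>M borel)}"

definition excess :: "nat \<Rightarrow> nat \<Rightarrow> (nat \<Rightarrow> 'a) \<Rightarrow> (nat \<Rightarrow>\<^sub>0 real) set \<Rightarrow> (nat \<Rightarrow> 'a \<Rightarrow> real)
    \<Rightarrow> ('a \<Rightarrow> real) \<Rightarrow> ('a \<Rightarrow> real) \<Rightarrow> real" where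
  "excess n M X H fs f g = (emp_norm n X (\<lambda>x. g x - f x))\<^sup>2
     - (INF v\<in>H. (emp_norm n X (\<lambda>x. lin_comb M fs v x - f x))\<^sup>2)"

definition aggregation_C :: "nat \<Rightarrow> nat \<Rightarrow> (nat \<Rightarrow>\<^sub>0 real) set \<Rightarrow> real \<Rightarrow> bool" where
  "aggregation_C n M H \<psi> \<longleftrightarrow> H = Lambda M \<and>
     \<psi> = (if real M \<le> sqrt (real n) then real M / real n
          else sqrt (ln (1 + real M / sqrt (real n)) / real n))"

definition aggregation_MS :: "nat \<Rightarrow> nat \<Rightarrow> (nat \<Rightarrow>\<^sub>0 real) set \<Rightarrow> real \<Rightarrow> bool" where
  "aggregation_MS n M H \<psi> \<longleftrightarrow> H = {v. v extreme_point_of Lambda M} - {0} \<and>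
     \<psi> = ln (real M) / real n"

definition aggregation_S :: "nat \<Rightarrow> nat \<Rightarrow> nat \<Rightarrow> (nat \<Rightarrow>\<^sub>0 real) set \<Rightarrow> real \<Rightarrow> bool" where
  "aggregation_S n M D H \<psi> \<longleftrightarrow> 1 \<le> D \<and> D \<le> M \<and>
     real M * ln (real M / real D + 1) \<le> real n \<and> H = Lambda_sparse M D \<and>
     \<psi> = real D * ln (1 + real M / real D) / real n"

end

theory Submission
  imports Defs
begin

text \<open>
  In all three problems the class \<open>{f\<^sub>\<lambda> : \<lambda> \<in> H}\<close> contains, for a suitable dictionary, the vertices
  \<open>a * (\<Sum>j. \<plusminus> \<phi>\<^sub>j)\<close> of a cube, with \<open>a = min L \<sigma>\<close> and \<open>K\<close> vectors \<open>\<phi>\<^sub>j\<close> orthonormal in \<open>R\<^sup>n\<close>, where \<open>K\<close>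
  is at least a constant times \<open>n * \<psi>\<close>. At a vertex the oracle term vanishes. Flipping one sign moves
  the mean by \<open>2 * a \<le> 2 * \<sigma>\<close>, so no test detects it reliably, and under the uniform prior any
  estimator gets a fixed fraction of the signs wrong on average. By Bessel's inequality every wrong
  sign costs \<open>a\<^sup>2 / n\<close> in the squared empirical norm. The number of wrong signs never exceeds \<open>K\<close>, so
  it is of order \<open>K\<close> with probability bounded below, which is what a general loss \<open>w\<close> requires.
\<close>

subsection \<open>Two Gaussian shift experiments\<close>

text \<open>With fixed design points, the data under a regression function are determined in law by
  the vector \<theta> of its values there. Testing is therefore done between mean vectors, and
  functions enter only afterwards.\<close>

definition gaussian_law :: "nat \<Rightarrow> real \<Rightarrow> (nat \<Rightarrow> real) \<Rightarrow> (nat \<Rightarrow> real) measure" where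
  "gaussian_law n \<sigma> \<theta> =
     (\<Pi>\<^sub>M i\<in>{1..n}. density lborel (\<lambda>x. ennreal (normal_density (\<theta> i) \<sigma> x)))"

lemma gaussian_noise_eq_law: "gaussian_noise n \<sigma> = gaussian_law n \<sigma> (\<lambda>_. 0)"
  by (simp add: gaussian_noise_def gaussian_law_def)

lemma sets_gaussian_law [measurable_cong]:
  "sets (gaussian_law n \<sigma> \<theta>) = sets (\<Pi>\<^sub>M i\<in>{1..n}. borel)"
  unfolding gaussian_law_def by (intro sets_PiM_cong) auto

lemma space_gaussian_law: "space (gaussian_law n \<sigma> \<theta>) = space (\<Pi>\<^sub>M i\<in>{1..n}. borel)"
  by (rule sets_eq_imp_space_eq) (rule sets_gaussian_law)

lemma prob_space_gaussian_law:
  assumes "0 < \<sigma>"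
  shows "prob_space (gaussian_law n \<sigma> \<theta>)"
  unfolding gaussian_law_def by (intro prob_space_PiM prob_space_normal_density assms)

lemma distr_normal_shift:
  assumes "0 < \<sigma>"
  shows "distr (density lborel (\<lambda>x. ennreal (normal_density 0 \<sigma> x))) borel (\<lambda>x. t + x)
    = density lborel (\<lambda>x. ennreal (normal_density t \<sigma> x))"
proof -
  interpret prob_space "density lborel (\<lambda>x. ennreal (normal_density 0 \<sigma> x))"
    by (intro prob_space_normal_density assms)
  have "distributed (density lborel (\<lambda>x. ennreal (normal_density 0 \<sigma> x))) lborel (\<lambda>x. x)
      (\<lambda>x. ennreal (normal_density 0 \<sigma> x))"
    unfolding distributed_def by (auto simp: distr_id2)
  from normal_density_affine[OF this assms, of 1 t]
  have "distr (density lborel (\<lambda>x. ennreal (normal_density 0 \<sigma> x))) lborel (\<lambda>x. t + x)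
    = density lborel (\<lambda>x. ennreal (normal_density t \<sigma> x))"
    by (simp add: distributed_def)
  moreover have "distr (density lborel (\<lambda>x. ennreal (normal_density 0 \<sigma> x))) lborel (\<lambda>x. t + x)
    = distr (density lborel (\<lambda>x. ennreal (normal_density 0 \<sigma> x))) borel (\<lambda>x. t + x)"
    by (intro distr_cong) auto
  ultimately show ?thesis by simp
qed

text \<open>The translation acts coordinatewise, so preimages of boxes are boxes, and boxes
  determine a finite product measure. This passes from integrals over the noise to integrals over
  the observations.\<close>

lemma distr_gaussian_noise:
  assumes "0 < \<sigma>"
  shows "distr (gaussian_noise n \<sigma>) (\<Pi>\<^sub>M i\<in>{1..n}. borel) (\<lambda>W. \<lambda>i\<in>{1..n}. \<theta> i + W i)
    = gaussian_law n \<sigma> \<theta>"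
proof -
  let ?N = "\<lambda>i. density lborel (\<lambda>x. ennreal (normal_density (\<theta> i) \<sigma> x))"
  let ?Z = "\<lambda>i::nat. density lborel (\<lambda>x. ennreal (normal_density 0 \<sigma> x))"
  interpret N: product_prob_space ?N UNIV
    by (intro product_prob_spaceI prob_space_normal_density assms)
  have N0: "product_sigma_finite ?Z"
    by (intro product_sigma_finite.intro prob_space_imp_sigma_finite prob_space_normal_density assms)
  have meas: "(\<lambda>W. \<lambda>i\<in>{1..n}. \<theta> i + W i) \<in> PiM {1..n} ?Z \<rightarrow>\<^sub>M (\<Pi>\<^sub>M i\<in>{1..n}. borel)"
    by measurable
  have "distr (PiM {1..n} ?Z) (\<Pi>\<^sub>M i\<in>{1..n}. borel) (\<lambda>W. \<lambda>i\<in>{1..n}. \<theta> i + W i) = PiM {1..n} ?N"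
  proof (rule N.PiM_eqI)
    show "sets (distr (PiM {1..n} ?Z) (\<Pi>\<^sub>M i\<in>{1..n}. borel) (\<lambda>W. \<lambda>i\<in>{1..n}. \<theta> i + W i))
      = sets (PiM {1..n} ?N)"
      by (simp, intro sets_PiM_cong) auto
    fix A assume A: "\<And>i. i \<in> {1..n} \<Longrightarrow> A i \<in> sets (?N i)"
    have pre: "(\<lambda>W. \<lambda>i\<in>{1..n}. \<theta> i + W i) -` Pi\<^sub>E {1..n} A \<inter> space (PiM {1..n} ?Z)
      = Pi\<^sub>E {1..n} (\<lambda>i. (\<lambda>x. \<theta> i + x) -` A i)"
      by (auto simp: space_PiM PiE_def Pi_def extensional_def)
    have mA: "(\<lambda>x. \<theta> i + x) -` A i \<in> sets borel" if "i \<in> {1..n}" for i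
    proof -
      have "(\<lambda>x. \<theta> i + x) -` A i \<inter> space borel \<in> sets borel"
        using A[OF that] by (intro measurable_sets[of _ borel borel]) auto
      then show ?thesis by simp
    qed
    have "emeasure (distr (PiM {1..n} ?Z) (\<Pi>\<^sub>M i\<in>{1..n}. borel) (\<lambda>W. \<lambda>i\<in>{1..n}. \<theta> i + W i))
        (Pi\<^sub>E {1..n} A) = emeasure (PiM {1..n} ?Z) (Pi\<^sub>E {1..n} (\<lambda>i. (\<lambda>x. \<theta> i + x) -` A i))"
      unfolding pre[symmetric] using A by (intro emeasure_distr[OF meas] sets_PiM_I_finite) simp_all
    also have "\<dots> = (\<Prod>i\<in>{1..n}. emeasure (?Z i) ((\<lambda>x. \<theta> i + x) -` A i))"
      using mA by (intro product_sigma_finite.emeasure_PiM[OF N0]) auto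
    also have "\<dots> = (\<Prod>i\<in>{1..n}. emeasure (?N i) (A i))"
    proof (intro prod.cong refl)
      fix i assume i: "i \<in> {1..n}"
      have "emeasure (?N i) (A i) = emeasure (distr (?Z i) borel (\<lambda>x. \<theta> i + x)) (A i)"
        by (simp only: distr_normal_shift[OF assms])
      also have "\<dots> = emeasure (?Z i) ((\<lambda>x. \<theta> i + x) -` A i)"
        using A[OF i] by (subst emeasure_distr) auto
      finally show "emeasure (?Z i) ((\<lambda>x. \<theta> i + x) -` A i) = emeasure (?N i) (A i)" ..
    qed
    finally show "emeasure (distr (PiM {1..n} ?Z) (\<Pi>\<^sub>M i\<in>{1..n}. borel)
        (\<lambda>W. \<lambda>i\<in>{1..n}. \<theta> i + W i)) (Pi\<^sub>E {1..n} A) = (\<Prod>i\<in>{1..n}. emeasure (?N i) (A i))" .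
  qed simp
  then show ?thesis
    by (simp add: gaussian_noise_def gaussian_law_def)
qed

text \<open>Both sides give every box the same mass, by Tonelli for products. All mean vectors now
  share one dominating measure, so two laws can be compared through their densities
  pointwise.\<close>

lemma gaussian_law_eq_density:
  assumes "0 < \<sigma>"
  shows "gaussian_law n \<sigma> \<theta> = density (\<Pi>\<^sub>M i\<in>{1..n}. lborel)
    (\<lambda>y. ennreal (\<Prod>i=1..n. normal_density (\<theta> i) \<sigma> (y i)))"
proof -
  let ?N = "\<lambda>i. density lborel (\<lambda>x. ennreal (normal_density (\<theta> i) \<sigma> x))"
  let ?L = "\<lambda>i::nat. lborel :: real measure"
  interpret N: product_prob_space ?N UNIV
    by (intro product_prob_spaceI prob_space_normal_density assms)
  interpret L: product_sigma_finite ?L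
    by standard
  have "density (PiM {1..n} ?L) (\<lambda>y. ennreal (\<Prod>i=1..n. normal_density (\<theta> i) \<sigma> (y i)))
    = gaussian_law n \<sigma> \<theta>"
    unfolding gaussian_law_def
  proof (rule N.PiM_eqI)
    show "sets (density (PiM {1..n} ?L) (\<lambda>y. ennreal (\<Prod>i=1..n. normal_density (\<theta> i) \<sigma> (y i))))
      = sets (PiM {1..n} ?N)"
      by (simp, intro sets_PiM_cong) auto
    fix A assume A: "\<And>i. i \<in> {1..n} \<Longrightarrow> A i \<in> sets (?N i)"
    then have A': "A i \<in> sets borel" if "i \<in> {1..n}" for i using that by simp
    have PA: "Pi\<^sub>E {1..n} A \<in> sets (PiM {1..n} ?L)"
    proof (intro sets_PiM_I_finite)
      fix i assume "i \<in> {1..n}"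
      then show "A i \<in> sets lborel" using A'[of i] by simp
    qed simp
    have "emeasure (density (PiM {1..n} ?L) (\<lambda>y. ennreal (\<Prod>i=1..n. normal_density (\<theta> i) \<sigma> (y i))))
        (Pi\<^sub>E {1..n} A)
      = (\<integral>\<^sup>+y. ennreal (\<Prod>i=1..n. normal_density (\<theta> i) \<sigma> (y i)) * indicator (Pi\<^sub>E {1..n} A) y
          \<partial>PiM {1..n} ?L)"
    proof (rule emeasure_density[OF _ PA])
      show "(\<lambda>y. ennreal (\<Prod>i=1..n. normal_density (\<theta> i) \<sigma> (y i))) \<in> borel_measurable (PiM {1..n} ?L)"
        by measurable
    qed
    also have "\<dots> = (\<integral>\<^sup>+y. (\<Prod>i\<in>{1..n}. ennreal (normal_density (\<theta> i) \<sigma> (y i)) * indicator (A i) (y i))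
          \<partial>PiM {1..n} ?L)"
    proof (rule nn_integral_cong)
      fix y assume y: "y \<in> space (PiM {1..n} ?L)"
      have "(\<Prod>i\<in>{1..n}. indicator (A i) (y i)) = (indicator (Pi\<^sub>E {1..n} A) y :: ennreal)"
        using y by (auto simp: indicator_def space_PiM PiE_def intro!: prod.neutral prod_zero)
      then show "ennreal (\<Prod>i=1..n. normal_density (\<theta> i) \<sigma> (y i)) * indicator (Pi\<^sub>E {1..n} A) y
        = (\<Prod>i\<in>{1..n}. ennreal (normal_density (\<theta> i) \<sigma> (y i)) * indicator (A i) (y i))"
        by (simp add: prod.distrib prod_ennreal)
    qed
    also have "\<dots> = (\<Prod>i\<in>{1..n}. \<integral>\<^sup>+x. ennreal (normal_density (\<theta> i) \<sigma> x) * indicator (A i) x \<partial>lborel)"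
      using A' by (intro L.product_nn_integral_prod) auto
    also have "\<dots> = (\<Prod>i\<in>{1..n}. emeasure (?N i) (A i))"
      using A by (intro prod.cong refl) (auto simp: emeasure_density)
    finally show "emeasure (density (PiM {1..n} ?L)
        (\<lambda>y. ennreal (\<Prod>i=1..n. normal_density (\<theta> i) \<sigma> (y i)))) (Pi\<^sub>E {1..n} A)
      = (\<Prod>i\<in>{1..n}. emeasure (?N i) (A i))" .
  qed simp
  then show ?thesis ..
qed

text \<open>Completing the square in the exponent. This is the pointwise form of the Hellinger
  affinity of two normal laws, squared to avoid roots.\<close>

lemma normal_density_mult_midpoint:
  assumes "0 < \<sigma>"
  shows "normal_density a \<sigma> x * normal_density b \<sigma> x
    = (normal_density ((a + b) / 2) \<sigma> x)\<^sup>2 * exp (- ((a - b)\<^sup>2 / (4 * \<sigma>\<^sup>2)))"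
proof -
  have "- (x - a)\<^sup>2 / (2 * \<sigma>\<^sup>2) + - (x - b)\<^sup>2 / (2 * \<sigma>\<^sup>2)
    = 2 * (- (x - (a + b) / 2)\<^sup>2 / (2 * \<sigma>\<^sup>2)) + - ((a - b)\<^sup>2 / (4 * \<sigma>\<^sup>2))"
    using assms by (simp add: field_simps power2_eq_square)
  from arg_cong[OF this, of exp] show ?thesis
    unfolding normal_density_def power_mult_distrib exp_add exp_double
    by (simp add: power2_eq_square)
qed

text \<open>
  The geometric mean of two Gaussian densities is a multiple of the density centred at the midpoint.
  AM-GM with weights \<open>4\<close> and \<open>1 / 4\<close> bounds that density by the error density of the test plus a
  quarter of both densities. Integrating leaves the errors with at least \<open>1 - 1 / 2\<close>, up to the factor \<open>4\<close>.
\<close>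

lemma gaussian_two_point:
  fixes \<theta> \<theta>' :: "nat \<Rightarrow> real"
  assumes \<sigma>: "0 < \<sigma>" and close: "(\<Sum>i=1..n. (\<theta> i - \<theta>' i)\<^sup>2) \<le> 4 * \<sigma>\<^sup>2"
    and A: "A \<in> sets (\<Pi>\<^sub>M i\<in>{1..n}. borel)"
  shows "1 / 8 \<le> measure (gaussian_law n \<sigma> \<theta>) A
    + measure (gaussian_law n \<sigma> \<theta>') (space (\<Pi>\<^sub>M i\<in>{1..n}. borel) - A)"
proof -
  let ?L = "\<Pi>\<^sub>M i\<in>{1..n}. (lborel :: real measure)"
  have sL: "sets ?L = sets (\<Pi>\<^sub>M i\<in>{1..n}. borel)" by (intro sets_PiM_cong) auto
  \<comment> \<open>A test that errs on \<open>A\<close> under \<theta> errs on the complement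
    \<open>B\<close> under \<theta>'.\<close>
  define B where "B = space (\<Pi>\<^sub>M i\<in>{1..n}. (borel :: real measure)) - A"
  have B: "B \<in> sets (\<Pi>\<^sub>M i\<in>{1..n}. borel)" using A unfolding B_def by blast
  have [measurable]: "A \<in> sets ?L" "B \<in> sets ?L" using A B sL by auto
  define d where "d \<theta> y = (\<Prod>i=1..n. normal_density (\<theta> i) \<sigma> (y i))" for \<theta> y
  have dm [measurable]: "d \<theta> \<in> borel_measurable ?L" for \<theta> unfolding d_def by measurable
  have d0: "0 \<le> d \<theta> y" for \<theta> y unfolding d_def by (intro prod_nonneg) auto
  define \<mu> where "\<mu> i = (\<theta> i + \<theta>' i) / 2" for i
  have law: "gaussian_law n \<sigma> \<theta> = density ?L (\<lambda>y. ennreal (d \<theta> y))" for \<theta>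
    unfolding d_def by (rule gaussian_law_eq_density[OF \<sigma>])
  have em: "emeasure (gaussian_law n \<sigma> \<theta>) C = (\<integral>\<^sup>+y. ennreal (d \<theta> y) * indicator C y \<partial>?L)"
    if "C \<in> sets ?L" for \<theta> C
    unfolding law by (rule emeasure_density[OF measurable_compose[OF dm measurable_ennreal] that])
  have one: "(\<integral>\<^sup>+y. ennreal (d \<theta> y) \<partial>?L) = 1" for \<theta>
  proof -
    interpret prob_space "gaussian_law n \<sigma> \<theta>" by (rule prob_space_gaussian_law[OF \<sigma>])
    have "emeasure (gaussian_law n \<sigma> \<theta>) (space ?L) = (\<integral>\<^sup>+y. ennreal (d \<theta> y) * indicator (space ?L) y \<partial>?L)"
      by (rule em) auto
    also have "\<dots> = (\<integral>\<^sup>+y. ennreal (d \<theta> y) \<partial>?L)"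
      by (intro nn_integral_cong) auto
    finally show ?thesis
      using emeasure_space_1 sets_eq_imp_space_eq[OF sL] by (simp add: space_gaussian_law)
  qed
  \<comment> \<open>Means at distance at most \<open>2 * \<sigma>\<close> keep the exponent above
    \<open>-1\<close>, and \<open>exp (-1)\<close> is at least \<open>1/4\<close>.\<close>
  have h: "(d \<mu> y)\<^sup>2 \<le> 4 * (d \<theta> y * d \<theta>' y)" for y
  proof -
    have "d \<theta> y * d \<theta>' y = (\<Prod>i=1..n. (normal_density (\<mu> i) \<sigma> (y i))\<^sup>2 * exp (- ((\<theta> i - \<theta>' i)\<^sup>2 / (4 * \<sigma>\<^sup>2))))"
      unfolding d_def prod.distrib[symmetric] \<mu>_def
      by (intro prod.cong refl normal_density_mult_midpoint \<sigma>)
    also have "\<dots> = (d \<mu> y)\<^sup>2 * exp (\<Sum>i=1..n. - ((\<theta> i - \<theta>' i)\<^sup>2 / (4 * \<sigma>\<^sup>2)))"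
      by (simp add: prod.distrib d_def prod_power_distrib exp_sum)
    also have "(\<Sum>i=1..n. - ((\<theta> i - \<theta>' i)\<^sup>2 / (4 * \<sigma>\<^sup>2))) = - ((\<Sum>i=1..n. (\<theta> i - \<theta>' i)\<^sup>2) / (4 * \<sigma>\<^sup>2))"
      by (simp add: sum_negf sum_divide_distrib)
    finally have eq: "d \<theta> y * d \<theta>' y = (d \<mu> y)\<^sup>2 * exp (- ((\<Sum>i=1..n. (\<theta> i - \<theta>' i)\<^sup>2) / (4 * \<sigma>\<^sup>2)))" .
    have "(\<Sum>i=1..n. (\<theta> i - \<theta>' i)\<^sup>2) / (4 * \<sigma>\<^sup>2) \<le> 1" using close \<sigma> by simp
    then have "exp (-1) \<le> exp (- ((\<Sum>i=1..n. (\<theta> i - \<theta>' i)\<^sup>2) / (4 * \<sigma>\<^sup>2)))" by simp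
    moreover have "(1/4 :: real) \<le> exp (-1)"
    proof -
      have "1/2 \<le> exp (-1/2 :: real)" using exp_ge_add_one_self[of "-1/2::real"] by simp
      then have "(1/2)\<^sup>2 \<le> (exp (-1/2 :: real))\<^sup>2" by (intro power_mono) auto
      then show ?thesis by (simp add: power2_eq_square exp_add[symmetric])
    qed
    ultimately have "1/4 \<le> exp (- ((\<Sum>i=1..n. (\<theta> i - \<theta>' i)\<^sup>2) / (4 * \<sigma>\<^sup>2)))" by linarith
    then have "(d \<mu> y)\<^sup>2 * (1/4) \<le> d \<theta> y * d \<theta>' y"
      unfolding eq by (intro mult_left_mono) auto
    then show ?thesis by simp
  qed
  \<comment> \<open>The numbers \<open>4 * p\<close> and \<open>q / 4\<close> have product
    \<open>p * q\<close>. Both orders are needed: the weight 4 must fall on \<theta> on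
    \<open>A\<close> and on \<theta>' on \<open>B\<close>.\<close>
  have amgm: "d \<mu> y \<le> 4 * d \<theta> y + d \<theta>' y / 4" "d \<mu> y \<le> 4 * d \<theta>' y + d \<theta> y / 4" for y
  proof -
    have "4 * (p * q) \<le> (4 * p + q / 4)\<^sup>2" if "0 \<le> p" "0 \<le> q" for p q :: real
    proof -
      have "(4 * p + q / 4)\<^sup>2 - 4 * (p * q) = (4 * p - q / 4)\<^sup>2"
        by (simp add: power2_eq_square algebra_simps)
      then show ?thesis using zero_le_power2[of "4 * p - q / 4"] by linarith
    qed
    from this[OF d0 d0, of \<theta> y \<theta>' y] this[OF d0 d0, of \<theta>' y \<theta> y] h[of y]
    have "(d \<mu> y)\<^sup>2 \<le> (4 * d \<theta> y + d \<theta>' y / 4)\<^sup>2" "(d \<mu> y)\<^sup>2 \<le> (4 * d \<theta>' y + d \<theta> y / 4)\<^sup>2"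
      by (simp_all only: mult.commute[of "d \<theta>' y"])
    then show "d \<mu> y \<le> 4 * d \<theta> y + d \<theta>' y / 4" "d \<mu> y \<le> 4 * d \<theta>' y + d \<theta> y / 4"
      using d0[of \<theta> y] d0[of \<theta>' y] by (auto intro: power2_le_imp_le)
  qed
  have "1 = (\<integral>\<^sup>+y. ennreal (d \<mu> y) \<partial>?L)" by (rule one[symmetric])
  also have "\<dots> \<le> (\<integral>\<^sup>+y. (ennreal 4 * (ennreal (d \<theta> y) * indicator A y)
      + ennreal 4 * (ennreal (d \<theta>' y) * indicator B y))
      + (ennreal (1/4) * ennreal (d \<theta> y) + ennreal (1/4) * ennreal (d \<theta>' y)) \<partial>?L)"
  proof (intro nn_integral_mono)
    fix y assume "y \<in> space ?L"
    then have "y \<in> A \<or> y \<in> B" by (auto simp: B_def space_PiM)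
    moreover have "A \<inter> B = {}" by (auto simp: B_def)
    ultimately have "(ennreal 4 * (ennreal (d \<theta> y) * indicator A y)
      + ennreal 4 * (ennreal (d \<theta>' y) * indicator B y))
      + (ennreal (1/4) * ennreal (d \<theta> y) + ennreal (1/4) * ennreal (d \<theta>' y))
      = ennreal ((4 * (d \<theta> y * indicator A y) + 4 * (d \<theta>' y * indicator B y)) + (1/4 * d \<theta> y + 1/4 * d \<theta>' y))"
      by (simp add: d0 ennreal_indicator[symmetric] ennreal_plus[symmetric] ennreal_mult[symmetric]
          del: ennreal_plus ennreal_numeral)
    moreover have "d \<mu> y \<le> (4 * (d \<theta> y * indicator A y) + 4 * (d \<theta>' y * indicator B y)) + (1/4 * d \<theta> y + 1/4 * d \<theta>' y)"
      using \<open>y \<in> A \<or> y \<in> B\<close> \<open>A \<inter> B = {}\<close> amgm[of y] d0[of \<theta> y] d0[of \<theta>' y]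
      by (auto simp: indicator_def)
    ultimately show "ennreal (d \<mu> y) \<le> (ennreal 4 * (ennreal (d \<theta> y) * indicator A y)
      + ennreal 4 * (ennreal (d \<theta>' y) * indicator B y))
      + (ennreal (1/4) * ennreal (d \<theta> y) + ennreal (1/4) * ennreal (d \<theta>' y))"
      by (simp only: ennreal_leI)
  qed
  also have "\<dots> = (ennreal 4 * emeasure (gaussian_law n \<sigma> \<theta>) A + ennreal 4 * emeasure (gaussian_law n \<sigma> \<theta>') B)
      + (ennreal (1/4) + ennreal (1/4))"
    by (simp add: nn_integral_add nn_integral_cmult one em del: ennreal_numeral ennreal_plus One_nat_def)
  also have "\<dots> = ennreal (4 * measure (gaussian_law n \<sigma> \<theta>) A + 4 * measure (gaussian_law n \<sigma> \<theta>') B + (1/4 + 1/4))"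
  proof -
    interpret P: prob_space "gaussian_law n \<sigma> \<theta>" by (rule prob_space_gaussian_law[OF \<sigma>])
    interpret P': prob_space "gaussian_law n \<sigma> \<theta>'" by (rule prob_space_gaussian_law[OF \<sigma>])
    have e: "ennreal a * ennreal x + ennreal a * ennreal y + (ennreal p + ennreal q)
        = ennreal (a * x + a * y + (p + q))" if "0 \<le> a" "0 \<le> x" "0 \<le> y" "0 \<le> p" "0 \<le> q" for a x y p q
      using that by (simp add: ennreal_mult)
    show ?thesis
      unfolding P.emeasure_eq_measure P'.emeasure_eq_measure by (rule e) simp_all
  qed
  finally have "1 \<le> 4 * measure (gaussian_law n \<sigma> \<theta>) A + 4 * measure (gaussian_law n \<sigma> \<theta>') B + (1/4 + 1/4)"
    by (subst (asm) ennreal_1[symmetric], subst (asm) ennreal_le_iff) auto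
  then show ?thesis unfolding B_def by simp
qed

subsection \<open>Assouad's method\<close>

text \<open>A subset of the index set encodes a sign pattern, its elements carrying the plus sign.
  Toggling moves to a neighbouring vertex of the cube.\<close>

definition toggle :: "'j \<Rightarrow> 'j set \<Rightarrow> 'j set" where
  "toggle j S = (if j \<in> S then S - {j} else insert j S)"

lemma toggle_toggle [simp]: "toggle j (toggle j S) = S"
  by (auto simp: toggle_def)

lemma mem_toggle_iff: "k \<in> toggle j S \<longleftrightarrow> (if k = j then j \<notin> S else k \<in> S)"
  by (auto simp: toggle_def)

lemma bij_betw_toggle: "j \<in> J \<Longrightarrow> bij_betw (toggle j) (Pow J) (Pow J)"
  by (rule bij_betw_byWitness[where f' = "toggle j"]) (auto simp: toggle_def)

text \<open>A reverse Markov inequality. The number \<open>N\<close> of events that occur is at most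
  \<open>K\<close>, hence at most \<open>K * indicator G + K / 32\<close>; its mean is at least
  \<open>K / 16\<close>, which leaves \<open>1 / 32\<close> for the probability of
  \<open>G\<close>.\<close>

lemma (in prob_space) prob_card_ge:
  assumes J: "finite J" "J \<noteq> {}" and E: "\<And>j. j \<in> J \<Longrightarrow> E j \<in> events"
    and avg: "real (card J) / 16 \<le> (\<Sum>j\<in>J. prob (E j))"
  shows "1 / 32 \<le> prob {y \<in> space M. real (card J) / 32 \<le> real (card {j \<in> J. y \<in> E j})}"
proof -
  define K where "K = real (card J)"
  have K: "0 < K" using J by (simp add: K_def card_gt_0_iff)
  define N where "N y = (\<Sum>j\<in>J. indicator (E j) y :: real)" for y
  have N: "real (card {j \<in> J. y \<in> E j}) = N y" for y
    using J(1) by (simp add: N_def indicator_def sum.If_cases Int_def)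
  define G where "G = {y \<in> space M. K / 32 \<le> N y}"
  have [measurable]: "N \<in> borel_measurable M"
    unfolding N_def using E by measurable
  have [measurable]: "G \<in> events" unfolding G_def by measurable
  have NK: "N y \<le> K" for y
    unfolding N[symmetric] K_def using J(1) by (simp add: card_mono)
  have "integrable M N"
    unfolding N_def using E
    by (intro Bochner_Integration.integrable_sum integrable_real_indicator) (auto simp: emeasure_eq_measure)
  have "expectation N = (\<Sum>j\<in>J. prob (E j))"
    unfolding N_def using E
    by (subst Bochner_Integration.integral_sum)
       (auto intro!: sum.cong simp: emeasure_eq_measure Int_absorb1 sets.sets_into_space)
  then have "K / 16 \<le> expectation N" using avg by (simp add: K_def)
  also have "expectation N \<le> expectation (\<lambda>y. K * indicator G y + K / 32)"
  proof (rule integral_mono[OF \<open>integrable M N\<close>])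
    fix y assume "y \<in> space M"
    then show "N y \<le> K * indicator G y + K / 32"
      using NK[of y] K by (auto simp: G_def indicator_def)
  qed (auto simp: emeasure_eq_measure)
  also have "\<dots> = K * prob G + K / 32"
    using sets.sets_into_space[OF \<open>G \<in> events\<close>]
    by (subst Bochner_Integration.integral_add) (auto simp: emeasure_eq_measure prob_space Int_absorb1)
  finally have "K * (1 / 32) \<le> K * prob G" by (simp add: field_simps)
  then have "1 / 32 \<le> prob G" using K by simp
  then show ?thesis by (simp add: G_def N K_def)
qed

text \<open>
  Assouad's method: under the uniform prior on sign patterns, flipping one sign gives two
  indistinguishable laws, so every coordinate decision is wrong with probability at least \<open>1 / 16\<close>.
\<close>

lemma assouad_gaussian:
  fixes \<theta> :: "'j set \<Rightarrow> nat \<Rightarrow> real"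
  assumes \<sigma>: "0 < \<sigma>" and J: "finite J" "J \<noteq> {}"
    and close: "\<And>S j. S \<subseteq> J \<Longrightarrow> j \<in> J \<Longrightarrow> (\<Sum>i=1..n. (\<theta> S i - \<theta> (toggle j S) i)\<^sup>2) \<le> 4 * \<sigma>\<^sup>2"
    and A: "\<And>j. j \<in> J \<Longrightarrow> A j \<in> sets (\<Pi>\<^sub>M i\<in>{1..n}. borel)"
  obtains S where "S \<subseteq> J"
    and "1 / 32 \<le> measure (gaussian_law n \<sigma> (\<theta> S))
      {y \<in> space (\<Pi>\<^sub>M i\<in>{1..n}. borel). real (card J) / 32 \<le> real (card {j\<in>J. (j \<in> S) = (y \<notin> A j)})}"
proof -
  let ?\<Omega> = "space (\<Pi>\<^sub>M i\<in>{1..n}. (borel :: real measure))"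
  \<comment> \<open>The test decides for the plus sign on \<open>A j\<close>, so
    \<open>E S j\<close> is the event that coordinate \<open>j\<close> of pattern \<open>S\<close>
    is decided wrongly.\<close>
  define E where "E S j = (if j \<in> S then ?\<Omega> - A j else A j)" for S j
  define P where "P S j = measure (gaussian_law n \<sigma> (\<theta> S)) (E S j)" for S j
  have E: "E S j \<in> sets (gaussian_law n \<sigma> \<theta>')" if "j \<in> J" for S j \<theta>'
    using A[OF that] by (auto simp: E_def sets_gaussian_law)
  have pair: "1 / 8 \<le> P S j + P (toggle j S) j" if "S \<subseteq> J" "j \<in> J" for S j
  proof (cases "j \<in> S")
    case True
    have "(\<Sum>i=1..n. (\<theta> (toggle j S) i - \<theta> S i)\<^sup>2) \<le> 4 * \<sigma>\<^sup>2"
      using close[OF that] by (simp add: power2_commute)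
    from gaussian_two_point[OF \<sigma> this A[OF that(2)]] True show ?thesis
      by (simp add: P_def E_def mem_toggle_iff add.commute)
  next
    case False
    from gaussian_two_point[OF \<sigma> close[OF that] A[OF that(2)]] False show ?thesis
      by (simp add: P_def E_def mem_toggle_iff)
  qed
  \<comment> \<open>Toggling permutes the cube, so twice the sum is a sum over pairs of neighbours,
    each contributing at least \<open>1 / 8\<close>.\<close>
  have coord: "card (Pow J) / 16 \<le> (\<Sum>S\<in>Pow J. P S j)" if "j \<in> J" for j
  proof -
    have "(\<Sum>S\<in>Pow J. P S j) = (\<Sum>S\<in>Pow J. P (toggle j S) j)"
      by (rule sum.reindex_bij_betw[OF bij_betw_toggle[OF that], symmetric])
    then have "2 * (\<Sum>S\<in>Pow J. P S j) = (\<Sum>S\<in>Pow J. P S j + P (toggle j S) j)"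
      by (simp add: sum.distrib)
    also have "\<dots> \<ge> (\<Sum>S\<in>Pow J. 1 / 8)"
      using pair that by (intro sum_mono) auto
    finally show ?thesis by simp
  qed
  \<comment> \<open>Averaged over the cube, the expected number of wrong decisions is at least
    \<open>card J / 16\<close>; some pattern reaches the average.\<close>
  have "\<exists>S\<in>Pow J. real (card J) / 16 \<le> (\<Sum>j\<in>J. P S j)"
  proof (rule ccontr)
    assume "\<not> ?thesis"
    then have "(\<Sum>j\<in>J. P S j) < real (card J) / 16" if "S \<in> Pow J" for S
      using that by (meson not_le)
    then have "(\<Sum>S\<in>Pow J. \<Sum>j\<in>J. P S j) < (\<Sum>S\<in>Pow J. real (card J) / 16)"
      using J(1) by (intro sum_strict_mono) auto
    moreover have "(\<Sum>S\<in>Pow J. \<Sum>j\<in>J. P S j) = (\<Sum>j\<in>J. \<Sum>S\<in>Pow J. P S j)"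
      by (rule sum.swap)
    moreover have "\<dots> \<ge> (\<Sum>j\<in>J. card (Pow J) / 16)"
      by (intro sum_mono coord)
    ultimately show False by (simp add: mult.commute)
  qed
  then obtain S where S: "S \<subseteq> J" "real (card J) / 16 \<le> (\<Sum>j\<in>J. P S j)" by auto
  interpret prob_space "gaussian_law n \<sigma> (\<theta> S)" by (rule prob_space_gaussian_law[OF \<sigma>])
  have "1 / 32 \<le> prob {y \<in> space (gaussian_law n \<sigma> (\<theta> S)).
      real (card J) / 32 \<le> real (card {j \<in> J. y \<in> E S j})}"
    using S(2) by (intro prob_card_ge J E) (auto simp: P_def)
  also have "{y \<in> space (gaussian_law n \<sigma> (\<theta> S)). real (card J) / 32 \<le> real (card {j \<in> J. y \<in> E S j})}
    = {y \<in> ?\<Omega>. real (card J) / 32 \<le> real (card {j\<in>J. (j \<in> S) = (y \<notin> A j)})}"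
  proof -
    have "{j \<in> J. y \<in> E S j} = {j\<in>J. (j \<in> S) = (y \<notin> A j)}" if "y \<in> ?\<Omega>" for y
      using that by (auto simp: E_def)
    then show ?thesis by (auto simp: space_gaussian_law)
  qed
  finally show ?thesis using S(1) by (intro that)
qed

subsection \<open>Minimax lower bound over a cube of regression functions\<close>

definition sgn_of :: "'j set \<Rightarrow> 'j \<Rightarrow> real" where
  "sgn_of S j = (if j \<in> S then 1 else - 1)"

lemma abs_sgn_of [simp]: "\<bar>sgn_of S j\<bar> = 1"
  by (simp add: sgn_of_def)

text \<open>Bessel's inequality: \<open>p\<close> is the orthogonal projection of \<open>r\<close>,
  and the squared length of \<open>r - p\<close> is nonnegative.\<close>

lemma bessel_sum:
  fixes \<phi> :: "'j \<Rightarrow> 'i \<Rightarrow> real"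
  assumes J: "finite J"
    and orth: "\<And>j k. j \<in> J \<Longrightarrow> k \<in> J \<Longrightarrow> (\<Sum>i\<in>I. \<phi> j i * \<phi> k i) = (if j = k then 1 else 0)"
  shows "(\<Sum>j\<in>J. (\<Sum>i\<in>I. r i * \<phi> j i)\<^sup>2) \<le> (\<Sum>i\<in>I. (r i)\<^sup>2)"
proof -
  define c where "c j = (\<Sum>i\<in>I. r i * \<phi> j i)" for j
  define p where "p i = (\<Sum>j\<in>J. c j * \<phi> j i)" for i
  have rp: "(\<Sum>i\<in>I. r i * p i) = (\<Sum>j\<in>J. (c j)\<^sup>2)"
  proof -
    have "(\<Sum>i\<in>I. r i * p i) = (\<Sum>i\<in>I. \<Sum>j\<in>J. c j * (r i * \<phi> j i))"
      by (simp add: p_def sum_distrib_left mult_ac)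
    also have "\<dots> = (\<Sum>j\<in>J. \<Sum>i\<in>I. c j * (r i * \<phi> j i))" by (rule sum.swap)
    also have "\<dots> = (\<Sum>j\<in>J. c j * c j)" by (simp add: sum_distrib_left[symmetric] c_def)
    finally show ?thesis by (simp add: power2_eq_square)
  qed
  have pp: "(\<Sum>i\<in>I. (p i)\<^sup>2) = (\<Sum>j\<in>J. (c j)\<^sup>2)"
  proof -
    have "(\<Sum>i\<in>I. (p i)\<^sup>2) = (\<Sum>i\<in>I. \<Sum>j\<in>J. \<Sum>k\<in>J. c j * c k * (\<phi> j i * \<phi> k i))"
      by (simp add: p_def power2_eq_square sum_product mult_ac)
    also have "\<dots> = (\<Sum>j\<in>J. \<Sum>i\<in>I. \<Sum>k\<in>J. c j * c k * (\<phi> j i * \<phi> k i))" by (rule sum.swap)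
    also have "\<dots> = (\<Sum>j\<in>J. \<Sum>k\<in>J. \<Sum>i\<in>I. c j * c k * (\<phi> j i * \<phi> k i))"
      by (intro sum.cong refl sum.swap)
    also have "\<dots> = (\<Sum>j\<in>J. \<Sum>k\<in>J. c j * c k * (if j = k then 1 else 0))"
      by (intro sum.cong refl) (simp add: sum_distrib_left[symmetric] orth)
    also have "\<dots> = (\<Sum>j\<in>J. (c j)\<^sup>2)" using J by (simp add: power2_eq_square if_distrib cong: if_cong)
    finally show ?thesis .
  qed
  have "0 \<le> (\<Sum>i\<in>I. (r i - p i)\<^sup>2)" by (intro sum_nonneg) auto
  also have "\<dots> = (\<Sum>i\<in>I. (r i)\<^sup>2) + (\<Sum>i\<in>I. (p i)\<^sup>2) - 2 * (\<Sum>i\<in>I. r i * p i)"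
    by (simp add: power2_diff sum_subtractf sum.distrib sum_distrib_left mult_ac)
  finally show ?thesis by (simp add: rp pp c_def)
qed

lemma emp_norm_power2: "(emp_norm n X g)\<^sup>2 = (\<Sum>i=1..n. (g (X i))\<^sup>2) / real n"
  by (simp add: emp_norm_def sum_nonneg)

text \<open>When the class reproduces \<open>f\<close> at the design points, the oracle term is at
  most zero and only the estimation error remains.\<close>

lemma excess_ge:
  assumes v: "v \<in> H" and rep: "\<And>i. i \<in> {1..n} \<Longrightarrow> lin_comb M fs v (X i) = f (X i)"
  shows "(\<Sum>i=1..n. (g (X i) - f (X i))\<^sup>2) / real n \<le> excess n M X H fs f g"
proof -
  have "(INF v\<in>H. (emp_norm n X (\<lambda>x. lin_comb M fs v x - f x))\<^sup>2)
      \<le> (emp_norm n X (\<lambda>x. lin_comb M fs v x - f x))\<^sup>2"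
    by (intro cINF_lower v bdd_belowI[of _ 0]) auto
  also have "\<dots> = 0" by (simp add: emp_norm_power2 rep)
  finally show ?thesis by (simp add: excess_def emp_norm_power2)
qed

text \<open>With the design points frozen, the data are a measurable function of the responses
  alone, so an estimated value becomes a statistic in the Gaussian shift model.\<close>

lemma measurable_estimator_at:
  assumes T: "T \<in> estimators n \<X>" and X: "X ` {1..n} \<subseteq> \<X>" and x: "x \<in> \<X>"
  shows "(\<lambda>y. T (\<lambda>i\<in>{1..n}. (X i, y i)) x) \<in> borel_measurable (\<Pi>\<^sub>M i\<in>{1..n}. borel)"
proof -
  have "(\<lambda>y. \<lambda>i\<in>{1..n}. (X i, y i)) \<in>
    (\<Pi>\<^sub>M i\<in>{1..n}. borel) \<rightarrow>\<^sub>M (\<Pi>\<^sub>M i\<in>{1..n}. restrict_space borel \<X> \<Otimes>\<^sub>M borel)"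
  proof (rule measurable_restrict)
    fix i assume i: "i \<in> {1..n}"
    then have "X i \<in> space (restrict_space borel \<X>)" using X by (auto simp: space_restrict_space)
    with i show "(\<lambda>y. (X i, y i)) \<in> (\<Pi>\<^sub>M i\<in>{1..n}. borel) \<rightarrow>\<^sub>M restrict_space borel \<X> \<Otimes>\<^sub>M borel"
      by (intro measurable_Pair measurable_const measurable_component_singleton)
  qed
  from measurable_compose[OF this] T x show ?thesis unfolding estimators_def by blast
qed

text \<open>The analytic core: what remains for each problem is a dictionary that realises a cube of
  the right dimension \<open>K\<close>. With probability at least \<open>1 / 32\<close> at least
  \<open>K / 32\<close> signs are wrong, each costing \<open>a\<^sup>2 / n\<close>; with
  \<open>K\<close> at least \<open>n * \<psi> / 12\<close> this gives
  \<open>384 = 32 * 12\<close>.\<close>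

lemma minimax_risk_ge:
  fixes \<phi> :: "'j \<Rightarrow> nat \<Rightarrow> real" and X :: "nat \<Rightarrow> 'a::topological_space"
  assumes \<sigma>: "0 < \<sigma>" and a: "0 < a" "a \<le> \<sigma>" and w: "loss_function w"
    and X: "X ` {1..n} \<subseteq> \<X>" "inj_on X {1..n}" and n: "0 < n"
    and J: "finite J" "J \<noteq> {}"
    and orth: "\<And>j k. j \<in> J \<Longrightarrow> k \<in> J \<Longrightarrow> (\<Sum>i=1..n. \<phi> j i * \<phi> k i) = (if j = k then 1 else 0)"
    and G: "\<And>j i. j \<in> {1..M} \<Longrightarrow> i \<in> {1..n} \<Longrightarrow> \<bar>G j i\<bar> \<le> L"
    and \<theta>L: "\<And>S i. S \<subseteq> J \<Longrightarrow> i \<in> {1..n} \<Longrightarrow> \<bar>a * (\<Sum>j\<in>J. sgn_of S j * \<phi> j i)\<bar> \<le> L"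
    and rep: "\<And>S. S \<subseteq> J \<Longrightarrow> \<exists>v\<in>H. \<forall>i\<in>{1..n}.
      (\<Sum>j=1..M. Poly_Mapping.lookup v j * G j i) = a * (\<Sum>j\<in>J. sgn_of S j * \<phi> j i)"
    and \<psi>: "0 < \<psi>" "real n * \<psi> \<le> 12 * real (card J)"
  shows "\<exists>fs. (\<forall>j\<in>{1..M}. fs j \<in> F0 \<X> L) \<and>
    ennreal (w (a\<^sup>2 / 384) / 32) \<le> (INF T\<in>estimators n \<X>. SUP f\<in>F0 \<X> L.
      expect n \<sigma> X f (\<lambda>z. w (inverse \<psi> * excess n M X H fs f (T z))))"
proof -
  have L: "0 \<le> L" using \<theta>L[of "{}" 1] n by (auto intro: order_trans[OF abs_ge_zero])
  define \<theta> where "\<theta> S i = a * (\<Sum>j\<in>J. sgn_of S j * \<phi> j i)" for S i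
  \<comment> \<open>Values prescribed at the design points are extended by 0, which respects the
    bound \<open>L\<close>; injectivity of \<open>X\<close> makes the prescription
    consistent.\<close>
  define ext where "ext g x = (if x \<in> X ` {1..n} then g (inv_into {1..n} X x) else 0 :: real)" for g x
  have ext_X [simp]: "ext g (X i) = g i" if "i \<in> {1..n}" for g i
    using that X(2) by (simp add: ext_def del: atLeastAtMost_iff)
  have ext_F0: "ext g \<in> F0 \<X> L" if "\<And>i. i \<in> {1..n} \<Longrightarrow> \<bar>g i\<bar> \<le> L" for g
    using that L X(2) by (auto simp: F0_def ext_def simp del: atLeastAtMost_iff)
  define fs where "fs j = ext (G j)" for j
  have w_mono: "w s \<le> w t" if "s \<le> t" for s t using w that by (auto simp: loss_function_def mono_def)
  have w_nonneg: "0 \<le> w t" for t using w by (auto simp: loss_function_def)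
  define K where "K = real (card J)"
  have "ennreal (w (a\<^sup>2 / 384) / 32) \<le> (SUP f\<in>F0 \<X> L.
      expect n \<sigma> X f (\<lambda>z. w (inverse \<psi> * excess n M X H fs f (T z))))"
    if T: "T \<in> estimators n \<X>" for T
  proof -
    let ?B = "\<Pi>\<^sub>M i\<in>{1..n}. (borel :: real measure)"
    define \<tau> where "\<tau> y i = T (\<lambda>i\<in>{1..n}. (X i, y i)) (X i)" for y i
    have \<tau>: "(\<lambda>y. \<tau> y i) \<in> borel_measurable ?B" if "i \<in> {1..n}" for i
      unfolding \<tau>_def using that X(1) by (intro measurable_estimator_at[OF T X(1)]) auto
    define s where "s y j = (\<Sum>i=1..n. \<tau> y i * \<phi> j i)" for y j
    have [measurable]: "(\<lambda>y. s y j) \<in> borel_measurable ?B" for j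
      unfolding s_def by (intro borel_measurable_sum borel_measurable_times \<tau>) auto
    \<comment> \<open>The estimator is turned into a test: the sign of coordinate \<open>j\<close>
      is read off its inner product with \<open>\<phi> j\<close>, ties counting as plus.\<close>
    define A where "A j = {y \<in> space ?B. 0 \<le> s y j}" for j
    have A: "A j \<in> sets ?B" for j unfolding A_def by measurable
    \<comment> \<open>Flipping one sign moves the mean by \<open>2 * a\<close> times a unit
      vector.\<close>
    have close: "(\<Sum>i=1..n. (\<theta> S i - \<theta> (toggle j S) i)\<^sup>2) \<le> 4 * \<sigma>\<^sup>2" if "S \<subseteq> J" "j \<in> J" for S j
    proof -
      have "\<theta> S i - \<theta> (toggle j S) i = a * (2 * (sgn_of S j * \<phi> j i))" for i
      proof -
        have "(\<Sum>k\<in>J. sgn_of S k * \<phi> k i) - (\<Sum>k\<in>J. sgn_of (toggle j S) k * \<phi> k i)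
          = (\<Sum>k\<in>J. if k = j then 2 * (sgn_of S j * \<phi> j i) else 0)"
          unfolding sum_subtractf[symmetric]
          by (intro sum.cong refl) (auto simp: sgn_of_def mem_toggle_iff)
        also have "\<dots> = 2 * (sgn_of S j * \<phi> j i)" using J(1) that(2) by simp
        finally show ?thesis by (simp add: \<theta>_def right_diff_distrib[symmetric])
      qed
      moreover have "(a * (2 * (sgn_of S j * \<phi> j i)))\<^sup>2 = 4 * a\<^sup>2 * (\<phi> j i * \<phi> j i)" for i
        by (simp add: sgn_of_def power2_eq_square)
      ultimately have "(\<Sum>i=1..n. (\<theta> S i - \<theta> (toggle j S) i)\<^sup>2) = 4 * a\<^sup>2"
        using orth[OF that(2,2)] by (simp add: sum_distrib_left[symmetric])
      moreover have "a\<^sup>2 \<le> \<sigma>\<^sup>2" using a by (intro power_mono) auto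
      ultimately show ?thesis by simp
    qed
    obtain S where S: "S \<subseteq> J" and prob: "1 / 32 \<le> measure (gaussian_law n \<sigma> (\<theta> S))
        {y \<in> space ?B. K / 32 \<le> real (card {j\<in>J. (j \<in> S) = (y \<notin> A j)})}"
      using assouad_gaussian[where n = n and \<theta> = \<theta> and A = A, OF \<sigma> J close A] by (auto simp: K_def)
    define E where "E = {y \<in> space ?B. K / 32 \<le> real (card {j\<in>J. (j \<in> S) = (y \<notin> A j)})}"
    have E: "E \<in> sets ?B"
    proof -
      have "{y \<in> space ?B. K / 32 \<le> (\<Sum>j\<in>J. if (j \<in> S) = (y \<notin> A j) then 1 else 0)} \<in> sets ?B"
        using A by measurable
      also have "{y \<in> space ?B. K / 32 \<le> (\<Sum>j\<in>J. if (j \<in> S) = (y \<notin> A j) then 1 else 0)} = E"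
        using J(1) by (simp add: E_def sum.If_cases Int_def)
      finally show ?thesis .
    qed
    obtain v where v: "v \<in> H" "\<And>i. i \<in> {1..n} \<Longrightarrow> (\<Sum>j=1..M. Poly_Mapping.lookup v j * G j i) = \<theta> S i"
      using rep[OF S] unfolding \<theta>_def by blast
    have \<theta>_coord: "(\<Sum>i=1..n. \<theta> S i * \<phi> j i) = a * sgn_of S j" if "j \<in> J" for j
    proof -
      have "(\<Sum>i=1..n. \<theta> S i * \<phi> j i) = (\<Sum>i=1..n. \<Sum>k\<in>J. a * sgn_of S k * (\<phi> k i * \<phi> j i))"
        by (simp add: \<theta>_def sum_distrib_left sum_distrib_right mult_ac)
      also have "\<dots> = (\<Sum>k\<in>J. \<Sum>i=1..n. a * sgn_of S k * (\<phi> k i * \<phi> j i))" by (rule sum.swap)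
      also have "\<dots> = (\<Sum>k\<in>J. a * sgn_of S k * (if k = j then 1 else 0))"
        by (intro sum.cong refl) (simp add: sum_distrib_left[symmetric] orth that del: One_nat_def)
      also have "\<dots> = a * sgn_of S j" using J(1) that by (simp add: if_distrib cong: if_cong)
      finally show ?thesis .
    qed
    have loss: "w (a\<^sup>2 / 384) \<le> w (inverse \<psi> * excess n M X H fs (ext (\<theta> S)) (T (\<lambda>i\<in>{1..n}. (X i, y i))))"
      if y: "y \<in> E" for y
    proof (rule w_mono)
      let ?W = "{j\<in>J. (j \<in> S) = (y \<notin> A j)}"
      have "a\<^sup>2 * real (card ?W) = (\<Sum>j\<in>?W. a\<^sup>2)" by simp
      \<comment> \<open>If the decision is wrong, the estimated coefficient and the true one,
        \<open>a\<close> or \<open>- a\<close>, lie on opposite sides of 0 or the former is 0, so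
        they differ by at least \<open>a\<close>.\<close>
      also have "\<dots> \<le> (\<Sum>j\<in>?W. (\<Sum>i=1..n. (\<tau> y i - \<theta> S i) * \<phi> j i)\<^sup>2)"
      proof (rule sum_mono)
        fix j assume j: "j \<in> ?W"
        have "(\<Sum>i=1..n. (\<tau> y i - \<theta> S i) * \<phi> j i) = s y j - a * sgn_of S j"
          using \<theta>_coord[of j] j by (simp add: s_def left_diff_distrib sum_subtractf)
        moreover have "a \<le> \<bar>s y j - a * sgn_of S j\<bar>"
          using j y a(1) by (auto simp: A_def E_def sgn_of_def)
        ultimately show "a\<^sup>2 \<le> (\<Sum>i=1..n. (\<tau> y i - \<theta> S i) * \<phi> j i)\<^sup>2"
          using a(1) by (simp add: abs_le_square_iff[symmetric])
      qed
      also have "\<dots> \<le> (\<Sum>j\<in>J. (\<Sum>i=1..n. (\<tau> y i - \<theta> S i) * \<phi> j i)\<^sup>2)"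
        using J(1) by (intro sum_mono2) auto
      also have "\<dots> \<le> (\<Sum>i=1..n. (\<tau> y i - \<theta> S i)\<^sup>2)"
        by (rule bessel_sum[OF J(1) orth])
      also have "\<dots> \<le> real n * excess n M X H fs (ext (\<theta> S)) (T (\<lambda>i\<in>{1..n}. (X i, y i)))"
      proof -
        have "(\<Sum>i=1..n. (T (\<lambda>i\<in>{1..n}. (X i, y i)) (X i) - ext (\<theta> S) (X i))\<^sup>2) / real n
          \<le> excess n M X H fs (ext (\<theta> S)) (T (\<lambda>i\<in>{1..n}. (X i, y i)))"
          using v(2) by (intro excess_ge[OF v(1)]) (simp add: lin_comb_def fs_def del: atLeastAtMost_iff)
        moreover have "(\<Sum>i=1..n. (T (\<lambda>i\<in>{1..n}. (X i, y i)) (X i) - ext (\<theta> S) (X i))\<^sup>2)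
          = (\<Sum>i=1..n. (\<tau> y i - \<theta> S i)\<^sup>2)"
          by (intro sum.cong refl) (simp add: \<tau>_def del: atLeastAtMost_iff)
        ultimately show ?thesis using n by (simp add: field_simps)
      qed
      finally have 1: "a\<^sup>2 * real (card ?W)
        \<le> real n * excess n M X H fs (ext (\<theta> S)) (T (\<lambda>i\<in>{1..n}. (X i, y i)))" .
      have "a\<^sup>2 * (K / 32) \<le> a\<^sup>2 * real (card ?W)" using y by (intro mult_left_mono) (auto simp: E_def)
      moreover have "a\<^sup>2 * (real n * \<psi>) \<le> a\<^sup>2 * (12 * K)"
        using \<psi>(2) by (intro mult_left_mono) (auto simp: K_def)
      ultimately have "real n * (a\<^sup>2 / 384 * \<psi>)
        \<le> real n * excess n M X H fs (ext (\<theta> S)) (T (\<lambda>i\<in>{1..n}. (X i, y i)))"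
        using 1 by (simp add: algebra_simps)
      then have "a\<^sup>2 / 384 * \<psi> \<le> excess n M X H fs (ext (\<theta> S)) (T (\<lambda>i\<in>{1..n}. (X i, y i)))"
        using n by simp
      then show "a\<^sup>2 / 384 \<le> inverse \<psi> * excess n M X H fs (ext (\<theta> S)) (T (\<lambda>i\<in>{1..n}. (X i, y i)))"
        using \<psi>(1) by (simp add: field_simps)
    qed
    define shift where "shift W = (\<lambda>i\<in>{1..n}. \<theta> S i + W i)" for W :: "nat \<Rightarrow> real"
    have shift: "shift \<in> gaussian_noise n \<sigma> \<rightarrow>\<^sub>M ?B"
      unfolding shift_def gaussian_noise_eq_law by measurable
    have sample: "sample n X (ext (\<theta> S)) W = (\<lambda>i\<in>{1..n}. (X i, shift W i))" for W
      unfolding sample_def shift_def by (intro restrict_ext) (simp del: atLeastAtMost_iff)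
    interpret P: prob_space "gaussian_law n \<sigma> (\<theta> S)" by (rule prob_space_gaussian_law[OF \<sigma>])
    \<comment> \<open>The loss is bounded below by a constant times the indicator of the measurable
      set \<open>E\<close>; the change of variables is applied to that indicator.\<close>
    have "ennreal (w (a\<^sup>2 / 384) / 32) \<le> ennreal (w (a\<^sup>2 / 384)) * ennreal (measure (gaussian_law n \<sigma> (\<theta> S)) E)"
      using mult_left_mono[OF prob w_nonneg[of "a\<^sup>2 / 384"]]
      by (simp add: ennreal_mult[symmetric] w_nonneg E_def ennreal_leI)
    also have "\<dots> = (\<integral>\<^sup>+y. ennreal (w (a\<^sup>2 / 384)) * indicator E y \<partial>gaussian_law n \<sigma> (\<theta> S))"
      using E by (subst nn_integral_cmult_indicator) (auto simp: sets_gaussian_law P.emeasure_eq_measure)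
    also have "\<dots> = (\<integral>\<^sup>+y. ennreal (w (a\<^sup>2 / 384)) * indicator E y \<partial>distr (gaussian_noise n \<sigma>) ?B shift)"
      unfolding shift_def distr_gaussian_noise[OF \<sigma>] ..
    also have "\<dots> = (\<integral>\<^sup>+W. ennreal (w (a\<^sup>2 / 384)) * indicator E (shift W) \<partial>gaussian_noise n \<sigma>)"
      by (intro nn_integral_distr shift borel_measurable_times_ennreal borel_measurable_const
          borel_measurable_indicator) (simp only: sets_distr E)
    also have "\<dots> \<le> expect n \<sigma> X (ext (\<theta> S)) (\<lambda>z. w (inverse \<psi> * excess n M X H fs (ext (\<theta> S)) (T z)))"
      unfolding expect_def sample
      by (intro nn_integral_mono) (auto simp: indicator_def simp del: One_nat_def intro!: ennreal_leI loss)
    also have "\<dots> \<le> (SUP f\<in>F0 \<X> L. expect n \<sigma> X f (\<lambda>z. w (inverse \<psi> * excess n M X H fs f (T z))))"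
      using \<theta>L[OF S] by (intro SUP_upper ext_F0) (simp add: \<theta>_def)
    finally show ?thesis .
  qed
  then have "ennreal (w (a\<^sup>2 / 384) / 32) \<le> (INF T\<in>estimators n \<X>. SUP f\<in>F0 \<X> L.
      expect n \<sigma> X f (\<lambda>z. w (inverse \<psi> * excess n M X H fs f (T z))))"
    by (intro INF_greatest)
  moreover have "\<forall>j\<in>{1..M}. fs j \<in> F0 \<X> L"
    unfolding fs_def using G by (intro ballI ext_F0)
  ultimately show ?thesis by blast
qed

subsection \<open>Dictionaries built from blocks\<close>

definition const_on :: "nat set \<Rightarrow> real \<Rightarrow> nat \<Rightarrow>\<^sub>0 real" where
  "const_on A \<gamma> = Abs_poly_mapping (\<lambda>j. if j \<in> A then \<gamma> else 0)"

lemma lookup_const_on: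
  "finite A \<Longrightarrow> Poly_Mapping.lookup (const_on A \<gamma>) j = (if j \<in> A then \<gamma> else 0)"
  unfolding const_on_def by (subst lookup_Abs_poly_mapping) auto

lemma keys_const_on:
  "finite A \<Longrightarrow> \<gamma> \<noteq> 0 \<Longrightarrow> Poly_Mapping.keys (const_on A \<gamma>) = A"
  by (auto simp: in_keys_iff lookup_const_on split: if_splits)

lemma lookup_scaleR:
  "Poly_Mapping.lookup (r *\<^sub>R v) i = r *\<^sub>R Poly_Mapping.lookup v i"
  unfolding scaleR_poly_mapping_def
  by (subst lookup_Abs_poly_mapping) (auto intro: finite_subset[OF _ finite_keys[of v]] simp: in_keys_iff)

lemma const_on_in_Lambda:
  assumes A: "A \<subseteq> {1..M}" and \<gamma>: "0 < \<gamma>" "real (card A) * \<gamma> \<le> 1"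
  shows "const_on A \<gamma> \<in> Lambda M"
proof -
  have fin: "finite A" using A by (rule finite_subset) simp
  have "(\<Sum>j=1..M. Poly_Mapping.lookup (const_on A \<gamma>) j) = (\<Sum>j\<in>A. \<gamma>)"
    using A fin by (subst sum.mono_neutral_right[of "{1..M}" A]) (auto simp: lookup_const_on)
  then show ?thesis
    using A \<gamma> fin by (auto simp: Lambda_def coeff_space_def keys_const_on lookup_const_on)
qed

text \<open>On \<open>Lambda M\<close> coordinate \<open>j\<close> is at most 1 and every other
  coordinate at least 0. The vertex attains all these bounds, so both ends of a segment through it
  must attain them too.\<close>

lemma const_on_singleton_extreme:
  assumes j: "j \<in> {1..M}"
  shows "const_on {j} 1 extreme_point_of Lambda M"
  unfolding extreme_point_of_def
proof (intro conjI ballI notI)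
  show "const_on {j} 1 \<in> Lambda M" using j by (intro const_on_in_Lambda) auto
next
  fix a b assume ab: "a \<in> Lambda M" "b \<in> Lambda M" and "const_on {j} 1 \<in> open_segment a b"
  then obtain u where "a \<noteq> b" and u: "0 < u" "u < 1"
    and eq: "const_on {j} 1 = (1 - u) *\<^sub>R a + u *\<^sub>R b"
    by (auto simp: in_segment)
  have lookup: "(if i = j then 1 else 0) = (1 - u) * Poly_Mapping.lookup a i + u * Poly_Mapping.lookup b i"
    for i
    using arg_cong[OF eq, of "\<lambda>p. Poly_Mapping.lookup p i"]
    by (simp add: lookup_const_on lookup_add lookup_scaleR)
  have le1: "Poly_Mapping.lookup p j \<le> 1" if "p \<in> Lambda M" for p
  proof -
    have "Poly_Mapping.lookup p j \<le> (\<Sum>j=1..M. Poly_Mapping.lookup p j)"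
      using that j by (intro member_le_sum) (auto simp: Lambda_def)
    then show ?thesis using that by (simp add: Lambda_def)
  qed
  have nonneg: "0 \<le> Poly_Mapping.lookup p i" if "p \<in> Lambda M" for p i
  proof (cases "i \<in> {1..M}")
    case True
    then show ?thesis using that by (auto simp: Lambda_def)
  next
    case False
    then have "i \<notin> Poly_Mapping.keys p" using that by (auto simp: Lambda_def coeff_space_def)
    then show ?thesis by (simp add: in_keys_iff)
  qed
  have "Poly_Mapping.lookup a i = Poly_Mapping.lookup b i" for i
  proof (cases "i = j")
    case True
    have "(1 - u) * (1 - Poly_Mapping.lookup a j) + u * (1 - Poly_Mapping.lookup b j) = 0"
      using lookup[of j] by (simp add: algebra_simps)
    moreover have "0 \<le> (1 - u) * (1 - Poly_Mapping.lookup a j)" "0 \<le> u * (1 - Poly_Mapping.lookup b j)"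
      using u le1 ab by auto
    ultimately have "(1 - u) * (1 - Poly_Mapping.lookup a j) = 0" "u * (1 - Poly_Mapping.lookup b j) = 0"
      by linarith+
    then show ?thesis using u True by simp
  next
    case False
    have "0 \<le> (1 - u) * Poly_Mapping.lookup a i" "0 \<le> u * Poly_Mapping.lookup b i"
      using u nonneg ab by auto
    with lookup[of i] False have "(1 - u) * Poly_Mapping.lookup a i = 0" "u * Poly_Mapping.lookup b i = 0"
      by (simp_all only: if_False)
    then show ?thesis using u by simp
  qed
  then show False using \<open>a \<noteq> b\<close> by (simp add: poly_mapping_eqI)
qed

text \<open>At zero-based positions \<open>t = i - 1\<close>, block \<open>b\<close> consists of
  \<open>t = b * k + u\<close> with \<open>u < k\<close>, and \<open>m * k \<le> n\<close> keeps it
  inside the design.\<close>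

lemma sum_block:
  fixes h :: "nat \<Rightarrow> real"
  assumes "0 < k" "b < m" "m * k \<le> n"
  shows "(\<Sum>i=1..n. if (i - 1) div k = b then h ((i - 1) mod k) else 0) = (\<Sum>u<k. h u)"
proof -
  have le: "b * k + u < n" if "u < k" for u
  proof -
    have "b * k + u < Suc b * k" using that by simp
    also have "\<dots> \<le> m * k" using assms(2) by (intro mult_right_mono) auto
    finally show ?thesis using assms(3) by simp
  qed
  have "(\<Sum>i=1..n. if (i - 1) div k = b then h ((i - 1) mod k) else 0)
    = (\<Sum>t<n. if t div k = b then h (t mod k) else 0)"
    by (rule sum.reindex_bij_witness[of _ "\<lambda>t. t + 1" "\<lambda>i. i - 1"]) auto
  also have "\<dots> = (\<Sum>t\<in>{t \<in> {..<n}. t div k = b}. h (t mod k))"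
    by (rule sum.inter_filter[symmetric]) simp
  also have "\<dots> = (\<Sum>u<k. h u)"
    using assms(1) le
    by (intro sum.reindex_bij_witness[of _ "\<lambda>u. b * k + u" "\<lambda>t. t mod k"]) auto
  finally show ?thesis .
qed

text \<open>
  The design points split into \<open>m\<close> blocks of length \<open>k\<close>, the dictionary into \<open>D\<close> groups of \<open>2 ^ m\<close>
  functions. A function of group \<open>g\<close> is a sign pattern over the blocks times the profile \<open>\<xi> g\<close>
  within each block. Choosing one function per group realises every vertex of a cube of
  dimension \<open>D * m\<close>.
\<close>

lemma minimax_risk_ge_blocks:
  fixes \<xi> :: "nat \<Rightarrow> nat \<Rightarrow> real" and X :: "nat \<Rightarrow> 'a::topological_space"
  assumes \<sigma>: "0 < \<sigma>" and a: "0 < a" "a \<le> \<sigma>" "a \<le> L" and w: "loss_function w"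
    and X: "X ` {1..n} \<subseteq> \<X>" "inj_on X {1..n}"
    and pos: "0 < D" "0 < m" "0 < k" "0 < q"
    and points: "m * k \<le> n" and dict: "D * 2 ^ m \<le> M"
    and orth: "\<And>g h. g < D \<Longrightarrow> h < D \<Longrightarrow> (\<Sum>u<k. \<xi> g u * \<xi> h u) = (if g = h then q else 0)"
    and \<xi>1: "\<And>g u. \<bar>\<xi> g u\<bar> \<le> 1"
    and \<xi>_sum: "\<And>u. (\<Sum>g<D. \<bar>\<xi> g u\<bar>) \<le> sqrt q"
    and H: "\<And>A. A \<subseteq> {1..M} \<Longrightarrow> card A = D \<Longrightarrow> const_on A (1 / sqrt q) \<in> H"
    and \<psi>: "0 < \<psi>" "real n * \<psi> \<le> 12 * real (D * m)"
  shows "\<exists>fs. (\<forall>j\<in>{1..M}. fs j \<in> F0 \<X> L) \<and>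
    ennreal (w (a\<^sup>2 / 384) / 32) \<le> (INF T\<in>estimators n \<X>. SUP f\<in>F0 \<X> L.
      expect n \<sigma> X f (\<lambda>z. w (inverse \<psi> * excess n M X H fs f (T z))))"
proof -
  \<comment> \<open>Cube coordinates are pairs (group, block). The profile has squared length
    \<open>q\<close>, hence the factor \<open>1 / sqrt q\<close> in \<phi>.\<close>
  define J where "J = {..<D} \<times> {..<m}"
  define \<phi> where "\<phi> j i = (if (i - 1) div k = snd j then \<xi> (fst j) ((i - 1) mod k) / sqrt q else 0)"
    for j :: "nat \<times> nat" and i
  obtain e :: "nat \<Rightarrow> nat set" where e: "bij_betw e {..<2 ^ m} (Pow {..<m})"
    using finite_same_card_bij[of "{..<2 ^ m :: nat}" "Pow {..<m}"] by (auto simp: card_Pow)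
  \<comment> \<open>Dictionary index \<open>j\<close> is decoded from \<open>j - 1\<close>: the
    quotient by \<open>2 ^ m\<close> is the group, the remainder the number of the sign pattern.
    Points beyond the last block get 0.\<close>
  define G where "G j i = (if (i - 1) div k < m
      then a * sgn_of (e ((j - 1) mod 2 ^ m)) ((i - 1) div k) * \<xi> ((j - 1) div 2 ^ m) ((i - 1) mod k)
      else 0)" for j i
  have sum_\<phi>: "(\<Sum>b<m. sgn b * \<phi> (g, b) i)
      = (if (i - 1) div k < m then sgn ((i - 1) div k) * (\<xi> g ((i - 1) mod k) / sqrt q) else 0)"
    for sgn g i
    by (simp add: \<phi>_def if_distrib cong: if_cong)
  show ?thesis
  proof (rule minimax_risk_ge[where J = J and \<phi> = \<phi> and G = G])
    show "0 < n" using pos points by (metis gr0I mult_pos_pos not_le)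
    show "finite J" "J \<noteq> {}" using pos by (auto simp: J_def)
    show "real n * \<psi> \<le> 12 * real (card J)" using \<psi> by (simp add: J_def)
    show "(\<Sum>i=1..n. \<phi> x i * \<phi> y i) = (if x = y then 1 else 0)" if "x \<in> J" "y \<in> J" for x y
    proof -
      obtain g b h c where [simp]: "x = (g, b)" "y = (h, c)" by (cases x, cases y)
      have gh: "g < D" "h < D" "b < m" using that by (auto simp: J_def)
      show ?thesis
      proof (cases "b = c")
        case True
        have "(\<Sum>i=1..n. \<phi> x i * \<phi> y i)
          = (\<Sum>i=1..n. if (i - 1) div k = b then \<xi> g ((i - 1) mod k) * \<xi> h ((i - 1) mod k) / q else 0)"
          using pos True by (intro sum.cong refl) (simp add: \<phi>_def)
        also have "\<dots> = (\<Sum>u<k. \<xi> g u * \<xi> h u / q)"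
          by (rule sum_block[OF pos(3) gh(3) points])
        also have "\<dots> = (if g = h then 1 else 0)"
          using orth[OF gh(1,2)] pos by (simp add: sum_divide_distrib[symmetric])
        finally show ?thesis using True by simp
      next
        case False
        then show ?thesis by (auto intro!: sum.neutral simp: \<phi>_def)
      qed
    qed
    show "\<bar>G j i\<bar> \<le> L" for j i
    proof -
      have "a * \<bar>\<xi> g u\<bar> \<le> L" for g u
        using mult_left_mono[OF \<xi>1[of g u], of a] a by linarith
      then show ?thesis using a by (auto simp: G_def abs_mult)
    qed
    \<comment> \<open>Blocks are disjoint, so at each point at most one term per group survives, and
      \<open>\<xi>_sum\<close> bounds the sum over groups.\<close>
    show "\<bar>a * (\<Sum>j\<in>J. sgn_of S j * \<phi> j i)\<bar> \<le> L" for S i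
    proof -
      have "\<bar>\<Sum>j\<in>J. sgn_of S j * \<phi> j i\<bar> = \<bar>\<Sum>g<D. \<Sum>b<m. sgn_of S (g, b) * \<phi> (g, b) i\<bar>"
        by (simp add: J_def sum.cartesian_product)
      also have "\<dots> \<le> (\<Sum>g<D. \<bar>\<xi> g ((i - 1) mod k)\<bar> / sqrt q)"
      proof (rule order_trans[OF sum_abs], rule sum_mono)
        fix g
        have "\<bar>\<Sum>b<m. sgn_of S (g, b) * \<phi> (g, b) i\<bar>
          \<le> \<bar>\<xi> g ((i - 1) mod k) / sqrt q\<bar>"
          unfolding sum_\<phi>[of "\<lambda>b. sgn_of S (g, b)"] by (simp add: abs_mult)
        then show "\<bar>\<Sum>b<m. sgn_of S (g, b) * \<phi> (g, b) i\<bar> \<le> \<bar>\<xi> g ((i - 1) mod k)\<bar> / sqrt q"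
          using pos by simp
      qed
      also have "\<dots> \<le> 1"
        using \<xi>_sum[of "(i - 1) mod k"] pos by (simp add: sum_divide_distrib[symmetric])
      finally have "a * \<bar>\<Sum>j\<in>J. sgn_of S j * \<phi> j i\<bar> \<le> a * 1"
        by (rule mult_left_mono) (use a in simp)
      with a have "a * \<bar>\<Sum>j\<in>J. sgn_of S j * \<phi> j i\<bar> \<le> L" by linarith
      then show ?thesis using a by (simp add: abs_mult)
    qed
    show "\<exists>v\<in>H. \<forall>i\<in>{1..n}. (\<Sum>j=1..M. Poly_Mapping.lookup v j * G j i)
        = a * (\<Sum>j\<in>J. sgn_of S j * \<phi> j i)" for S
    proof -
      have "\<exists>c<2 ^ m. e c = {b. b < m \<and> (g, b) \<in> S}" for g
      proof -
        have "{b. b < m \<and> (g, b) \<in> S} \<in> e ` {..<2 ^ m}"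
          unfolding bij_betw_imp_surj_on[OF e] by auto
        then show ?thesis by (metis (no_types, lifting) imageE lessThan_iff)
      qed
      then obtain c where c: "\<And>g. c g < 2 ^ m" "\<And>g. e (c g) = {b. b < m \<and> (g, b) \<in> S}"
        by metis
      \<comment> \<open>\<open>c g\<close> numbers the pattern that \<open>S\<close> prescribes in
        group \<open>g\<close>, and \<open>t g\<close> is the matching one-based dictionary index.
        The weight \<open>1 / sqrt q\<close> then turns \<xi> into \<phi>.\<close>
      define t where "t g = g * 2 ^ m + c g + 1" for g
      have t: "(t g - 1) mod 2 ^ m = c g" "(t g - 1) div 2 ^ m = g" for g
        using c(1)[of g] by (simp_all add: t_def)
      have inj: "inj_on t B" for B by (rule inj_onI) (metis t(2))
      define A where "A = t ` {..<D}"
      have "t g \<in> {1..M}" if "g < D" for g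
      proof -
        have "t g \<le> Suc g * 2 ^ m" using c(1)[of g] by (simp add: t_def)
        also have "\<dots> \<le> D * 2 ^ m" using that by (intro mult_right_mono) auto
        finally show ?thesis using dict by (simp add: t_def)
      qed
      then have A: "A \<subseteq> {1..M}" by (auto simp: A_def)
      have "card A = D" unfolding A_def by (simp add: card_image inj)
      with A have "const_on A (1 / sqrt q) \<in> H" by (rule H)
      moreover have "(\<Sum>j=1..M. Poly_Mapping.lookup (const_on A (1 / sqrt q)) j * G j i)
          = a * (\<Sum>j\<in>J. sgn_of S j * \<phi> j i)" for i
      proof -
        have "finite A" by (simp add: A_def)
        then have "(\<Sum>j=1..M. Poly_Mapping.lookup (const_on A (1 / sqrt q)) j * G j i)
          = (\<Sum>j\<in>A. 1 / sqrt q * G j i)"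
          using A by (subst sum.mono_neutral_right[of "{1..M}" A]) (auto simp: lookup_const_on)
        also have "\<dots> = (\<Sum>g<D. 1 / sqrt q * G (t g) i)"
          unfolding A_def by (subst sum.reindex[OF inj]) simp
        also have "\<dots> = (\<Sum>g<D. a * (\<Sum>b<m. sgn_of S (g, b) * \<phi> (g, b) i))"
          unfolding sum_\<phi>[of "\<lambda>b. sgn_of S (_, b)"]
          by (intro sum.cong refl) (simp add: G_def t c(2) sgn_of_def del: One_nat_def)
        also have "\<dots> = a * (\<Sum>j\<in>J. sgn_of S j * \<phi> j i)"
          by (simp add: J_def sum.cartesian_product sum_distrib_left[symmetric])
        finally show ?thesis .
      qed
      ultimately show ?thesis by blast
    qed
  qed (fact \<sigma> a w X \<psi>)+
qed

subsection \<open>The three aggregation problems\<close>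

text \<open>Sylvester's doubling of Hadamard matrices: rows of the second half change sign on the
  second half of the columns.\<close>

lemma walsh_functions:
  "\<exists>\<xi> :: nat \<Rightarrow> nat \<Rightarrow> real. (\<forall>g u. \<bar>\<xi> g u\<bar> = 1) \<and>
    (\<forall>g<2 ^ r. \<forall>h<2 ^ r. (\<Sum>u<2 ^ r. \<xi> g u * \<xi> h u) = (if g = h then 2 ^ r else 0))"
proof (induction r)
  case 0
  then show ?case by (intro exI[of _ "\<lambda>_ _. 1"]) auto
next
  case (Suc r)
  define N :: nat where "N = 2 ^ r"
  have N: "0 < N" by (simp add: N_def)
  from Suc obtain \<xi> :: "nat \<Rightarrow> nat \<Rightarrow> real" where abs: "\<And>g u. \<bar>\<xi> g u\<bar> = 1"
    and orth': "\<And>g h. g < 2 ^ r \<Longrightarrow> h < 2 ^ r \<Longrightarrow>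
      (\<Sum>u<2 ^ r. \<xi> g u * \<xi> h u) = (if g = h then 2 ^ r else 0)"
    by blast
  have orth: "(\<Sum>u<N. \<xi> g u * \<xi> h u) = (if g = h then real N else 0)" if "g < N" "h < N" for g h
    using orth'[of g h] that by (simp add: N_def)
  define \<epsilon> :: "nat \<Rightarrow> real" where "\<epsilon> g = (if N \<le> g then - 1 else 1)" for g
  define \<zeta> where "\<zeta> g u = \<xi> (g mod N) (u mod N) * (if N \<le> u then \<epsilon> g else 1)" for g u
  have sum_\<zeta>: "(\<Sum>u<N + N. \<zeta> g u * \<zeta> h u) = (if g = h then real (N + N) else 0)"
    if gh: "g < N + N" "h < N + N" for g h
  proof -
    have "(\<Sum>u<N + N. \<zeta> g u * \<zeta> h u) = (\<Sum>u<N. \<zeta> g u * \<zeta> h u) + (\<Sum>u=N..<N + N. \<zeta> g u * \<zeta> h u)"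
      by (subst sum.union_disjoint[symmetric]) (auto intro!: sum.cong)
    also have "(\<Sum>u=N..<N + N. \<zeta> g u * \<zeta> h u) = (\<Sum>u<N. \<zeta> g (u + N) * \<zeta> h (u + N))"
      by (rule sum.reindex_bij_witness[of _ "\<lambda>u. u + N" "\<lambda>u. u - N"]) auto
    also have "\<dots> = \<epsilon> g * \<epsilon> h * (\<Sum>u<N. \<xi> (g mod N) u * \<xi> (h mod N) u)"
      by (simp add: \<zeta>_def sum_distrib_left mult_ac)
    also have "(\<Sum>u<N. \<zeta> g u * \<zeta> h u) = (\<Sum>u<N. \<xi> (g mod N) u * \<xi> (h mod N) u)"
      by (simp add: \<zeta>_def)
    also have "(\<Sum>u<N. \<xi> (g mod N) u * \<xi> (h mod N) u) = (if g mod N = h mod N then real N else 0)"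
      using N by (intro orth) auto
    \<comment> \<open>Distinct rows that agree modulo \<open>N\<close> lie in different halves,
      where the first factor vanishes; for equal rows it is 2.\<close>
    finally have eq: "(\<Sum>u<N + N. \<zeta> g u * \<zeta> h u)
      = (1 + \<epsilon> g * \<epsilon> h) * (if g mod N = h mod N then real N else 0)"
      by (simp add: algebra_simps)
    have g: "g mod N = (if N \<le> g then g - N else g)" and h: "h mod N = (if N \<le> h then h - N else h)"
      using gh by (auto simp: le_mod_geq)
    show ?thesis unfolding eq g h by (auto simp: \<epsilon>_def)
  qed
  have "\<bar>\<zeta> g u\<bar> = 1" for g u by (simp add: \<zeta>_def \<epsilon>_def abs_mult abs)
  moreover have "2 ^ Suc r = N + N" "2 ^ Suc r = real (N + N)" by (simp_all add: N_def)
  ultimately show ?case by (intro exI[of _ \<zeta>]) (simp only: sum_\<zeta> simp_thms cong: imp_cong)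
qed

section \<open>Logarithms and powers of two\<close>

lemma ln_le_of_le_power2:
  fixes x :: real
  assumes "0 < x" "x \<le> 2 ^ p"
  shows "ln x \<le> real p"
proof -
  have "ln x \<le> ln (2 ^ p)" using assms by simp
  also have "\<dots> = real p * ln 2" by (simp add: ln_realpow)
  also have "\<dots> \<le> real p * 1" using ln_le_minus_one[of "2::real"] by (intro mult_left_mono) auto
  finally show ?thesis by simp
qed

lemma ex_power2_ivl:
  assumes "2 \<le> (x::nat)"
  obtains m where "0 < m" "m < 2 ^ m" "2 ^ m \<le> x" "x < 2 ^ Suc m"
proof -
  obtain m where m: "2 ^ m \<le> x" "x < 2 ^ (m + 1)" using ex_power_ivl1[of 2 x] assms by auto
  moreover have "m \<noteq> 0" using m assms by (intro notI) auto
  ultimately show ?thesis by (intro that[of m]) auto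
qed

section \<open>Two block designs and the choice of parameters in each problem\<close>

context
  fixes \<sigma> a L :: real and w :: "real \<Rightarrow> real" and \<X> :: "'a::topological_space set"
    and X :: "nat \<Rightarrow> 'a" and n M :: nat
  assumes \<sigma>: "0 < \<sigma>" and a: "0 < a" "a \<le> \<sigma>" "a \<le> L" and w: "loss_function w"
    and X: "X ` {1..n} \<subseteq> \<X>" "inj_on X {1..n}" and M: "2 \<le> M" "M \<le> n"
begin

text \<open>Group \<open>g\<close> lives on the single point \<open>g\<close> of every block, so
  groups do not overlap and weight 1 suffices. The points always fit, as
  \<open>m * D \<le> D * 2 ^ m \<le> M \<le> n\<close>.\<close>

lemma minimax_risk_ge_disjoint:
  assumes pos: "0 < D" "0 < m" and dict: "D * 2 ^ m \<le> M"
    and H: "\<And>A. A \<subseteq> {1..M} \<Longrightarrow> card A = D \<Longrightarrow> const_on A 1 \<in> H"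
    and \<psi>: "0 < \<psi>" "real n * \<psi> \<le> 12 * real (D * m)"
  shows "\<exists>fs. (\<forall>j\<in>{1..M}. fs j \<in> F0 \<X> L) \<and>
    ennreal (w (a\<^sup>2 / 384) / 32) \<le> (INF T\<in>estimators n \<X>. SUP f\<in>F0 \<X> L.
      expect n \<sigma> X f (\<lambda>z. w (inverse \<psi> * excess n M X H fs f (T z))))"
proof (rule minimax_risk_ge_blocks[where D = D and m = m and k = D and q = 1
      and \<xi> = "\<lambda>g u. if g = u then 1 else 0"])
  have "m * D \<le> D * 2 ^ m" by (simp add: less_imp_le)
  then show "m * D \<le> n" using dict M by linarith
  show "(\<Sum>u<D. (if g = u then 1 else 0) * (if h = u then 1 else 0)) = (if g = h then 1 else 0 :: real)"
    if "g < D" "h < D" for g h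
    using that by (simp add: if_distrib[of "\<lambda>x. x * _"] cong: if_cong)
  show "(\<Sum>g<D. \<bar>if g = u then 1 else 0 :: real\<bar>) \<le> sqrt 1" for u
    by (simp add: if_distrib cong: if_cong)
  show "const_on A (1 / sqrt 1) \<in> H" if "A \<subseteq> {1..M}" "card A = D" for A
    using H[OF that] by simp
qed (fact \<sigma> a w X pos dict \<psi> | simp)+

text \<open>Convex weights must sum to at most 1, so long flat profiles are used: their length
  \<open>2 ^ r\<close> permits the small weight \<open>1 / sqrt (2 ^ r)\<close>. The condition on
  \<open>D\<^sup>2\<close> gives the simplex constraint, the uniform bound and enough Walsh
  functions.\<close>

lemma minimax_risk_ge_walsh:
  assumes pos: "0 < D" "0 < m" and points: "m * 2 ^ r \<le> n" and dict: "D * 2 ^ m \<le> M"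
    and D: "D\<^sup>2 \<le> 2 ^ r" and \<psi>: "0 < \<psi>" "real n * \<psi> \<le> 12 * real (D * m)"
  shows "\<exists>fs. (\<forall>j\<in>{1..M}. fs j \<in> F0 \<X> L) \<and>
    ennreal (w (a\<^sup>2 / 384) / 32) \<le> (INF T\<in>estimators n \<X>. SUP f\<in>F0 \<X> L.
      expect n \<sigma> X f (\<lambda>z. w (inverse \<psi> * excess n M X (Lambda M) fs f (T z))))"
proof -
  obtain \<xi> :: "nat \<Rightarrow> nat \<Rightarrow> real" where \<xi>: "\<And>g u. \<bar>\<xi> g u\<bar> = 1"
    and orth: "\<And>g h. g < 2 ^ r \<Longrightarrow> h < 2 ^ r \<Longrightarrow> (\<Sum>u<2 ^ r. \<xi> g u * \<xi> h u) = (if g = h then 2 ^ r else 0)"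
    using walsh_functions[of r] by blast
  have "D \<le> D\<^sup>2" by (simp add: power2_nat_le_imp_le power2_eq_square)
  then have D_le: "D \<le> 2 ^ r" using D by linarith
  have "(real D)\<^sup>2 \<le> 2 ^ r" using of_nat_mono[OF D, where 'a = real] by simp
  then have sqrt: "real D \<le> sqrt (2 ^ r)" by (rule real_le_rsqrt)
  show ?thesis
  proof (rule minimax_risk_ge_blocks[where D = D and m = m and k = "2 ^ r" and q = "2 ^ r" and \<xi> = \<xi>])
    show "(\<Sum>u<2 ^ r. \<xi> g u * \<xi> h u) = (if g = h then 2 ^ r else 0)" if "g < D" "h < D" for g h
      using that D_le by (intro orth) auto
    show "(\<Sum>g<D. \<bar>\<xi> g u\<bar>) \<le> sqrt (2 ^ r)" for u using sqrt by (simp add: \<xi>)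
    show "const_on A (1 / sqrt (2 ^ r)) \<in> Lambda M" if "A \<subseteq> {1..M}" "card A = D" for A
      using that sqrt by (intro const_on_in_Lambda) auto
  qed (fact \<sigma> a w X pos points dict \<psi> | simp add: \<xi>)+
qed

text \<open>A single group: each vertex selects one sign pattern, and \<open>M\<close> functions
  provide all patterns on about \<open>log M\<close> blocks.\<close>

lemma minimax_risk_ge_MS:
  assumes "aggregation_MS n M H \<psi>"
  shows "\<exists>fs. (\<forall>j\<in>{1..M}. fs j \<in> F0 \<X> L) \<and>
    ennreal (w (a\<^sup>2 / 384) / 32) \<le> (INF T\<in>estimators n \<X>. SUP f\<in>F0 \<X> L.
      expect n \<sigma> X f (\<lambda>z. w (inverse \<psi> * excess n M X H fs f (T z))))"
proof -
  have H: "H = {v. v extreme_point_of Lambda M} - {0}" and \<psi>: "\<psi> = ln (real M) / real n"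
    using assms by (auto simp: aggregation_MS_def)
  obtain m where m: "0 < m" "m < 2 ^ m" "2 ^ m \<le> M" "M < 2 ^ Suc m"
    using ex_power2_ivl[OF M(1)] .
  have "real M \<le> 2 ^ Suc m" using of_nat_mono[OF less_imp_le[OF m(4)], where 'a = real] by simp
  then have "ln (real M) \<le> real (Suc m)" using M by (intro ln_le_of_le_power2) auto
  then have "ln (real M) \<le> 12 * real (1 * m)" using m(1) by simp
  then have rate: "real n * \<psi> \<le> 12 * real (1 * m)" using M by (simp add: \<psi>)
  show ?thesis
  proof (rule minimax_risk_ge_disjoint[where D = 1 and m = m])
    show "const_on A 1 \<in> H" if A: "A \<subseteq> {1..M}" "card A = 1" for A
    proof -
      obtain j where "A = {j}" using A(2) by (auto simp: card_1_singleton_iff)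
      moreover have "Poly_Mapping.lookup (const_on {j} 1) j \<noteq> Poly_Mapping.lookup 0 j"
        by (simp add: lookup_const_on)
      then have "const_on {j} 1 \<noteq> 0" by metis
      ultimately show ?thesis using A(1) const_on_singleton_extreme[of j M] by (auto simp: H)
    qed
    show "0 < \<psi>" using M by (simp add: \<psi>)
  qed (use m rate in auto)
qed

lemma minimax_risk_ge_S:
  assumes "aggregation_S n M D H \<psi>"
  shows "\<exists>fs. (\<forall>j\<in>{1..M}. fs j \<in> F0 \<X> L) \<and>
    ennreal (w (a\<^sup>2 / 384) / 32) \<le> (INF T\<in>estimators n \<X>. SUP f\<in>F0 \<X> L.
      expect n \<sigma> X f (\<lambda>z. w (inverse \<psi> * excess n M X H fs f (T z))))"
proof -
  have D: "1 \<le> D" "D \<le> M" and H: "H = Lambda_sparse M D"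
    and \<psi>: "\<psi> = real D * ln (1 + real M / real D) / real n"
    using assms by (auto simp: aggregation_S_def)
  \<comment> \<open>Every group needs at least two functions to have a sign to hide, so
    \<open>D\<close> is cut to \<open>M div 2\<close>. The loss is at most a factor 3, attained at
    \<open>D = M = 3\<close>.\<close>
  define E where "E = min D (M div 2)"
  have E: "0 < E" "E \<le> D" "2 * E \<le> M" using D M by (auto simp: E_def)
  have DE: "D \<le> 3 * E" using D M by (auto simp: E_def min_def)
  have "2 \<le> M div E" using E by (simp add: less_eq_div_iff_mult_less_eq)
  then obtain m where m: "0 < m" "m < 2 ^ m" "2 ^ m \<le> M div E" "M div E < 2 ^ Suc m"
    using ex_power2_ivl by blast
  have dict: "E * 2 ^ m \<le> M"
    using m(3) E(1) by (simp add: less_eq_div_iff_mult_less_eq mult.commute)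
  have "M < E * 2 ^ Suc m"
    using m(4) E(1) by (simp add: div_less_iff_less_mult mult.commute)
  then have "real M \<le> real E * 2 ^ Suc m" using of_nat_mono[of M "E * 2 ^ Suc m", where 'a = real] by simp
  also have "\<dots> \<le> real D * 2 ^ Suc m" using E by (intro mult_right_mono) auto
  finally have "real M / real D \<le> 2 ^ Suc m" using D by (simp add: field_simps)
  moreover have "(1::real) \<le> 2 ^ Suc m" by (rule one_le_power) simp
  \<comment> \<open>The logarithm is at most \<open>m + 2\<close>, hence \<open>3 * m\<close>; with
    \<open>D \<le> 3 * E\<close> the rate costs the factor 9.\<close>
  ultimately have "1 + real M / real D \<le> 2 ^ Suc (Suc m)" by simp
  then have "ln (1 + real M / real D) \<le> real (Suc (Suc m))"
    using D M by (intro ln_le_of_le_power2) (auto intro: add_pos_nonneg)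
  also have "\<dots> \<le> 3 * real m" using m(1) by simp
  finally have "real D * ln (1 + real M / real D) \<le> real (3 * E) * (3 * real m)"
    using DE D M by (intro mult_mono of_nat_mono) auto
  also have "\<dots> \<le> 12 * real (E * m)" by simp
  finally have rate: "real n * \<psi> \<le> 12 * real (E * m)" using M by (simp add: \<psi>)
  show ?thesis
  proof (rule minimax_risk_ge_disjoint[where D = E and m = m])
    show "const_on A 1 \<in> H" if A: "A \<subseteq> {1..M}" "card A = E" for A
      using A E(2) finite_subset[OF A(1)] by (simp add: H Lambda_sparse_def coeff_space_def keys_const_on)
    have "0 < ln (1 + real M / real D)" using D M by (intro ln_gt_zero) simp
    then show "0 < \<psi>" using D M by (simp add: \<psi>)
  qed (use m E dict rate in auto)
qed

text \<open>For small \<open>M\<close> there are \<open>M div 2\<close> groups with one sign each.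
  For large \<open>M\<close>, \<open>m\<close> is of order \<open>ln x\<close> and \<open>D\<close>
  of order \<open>sqrt (n / m)\<close>, so \<open>D * m\<close> is of order
  \<open>sqrt (n * ln x)\<close>, which is \<open>n * \<psi>\<close>.\<close>

lemma minimax_risk_ge_C:
  assumes "aggregation_C n M H \<psi>"
  shows "\<exists>fs. (\<forall>j\<in>{1..M}. fs j \<in> F0 \<X> L) \<and>
    ennreal (w (a\<^sup>2 / 384) / 32) \<le> (INF T\<in>estimators n \<X>. SUP f\<in>F0 \<X> L.
      expect n \<sigma> X f (\<lambda>z. w (inverse \<psi> * excess n M X H fs f (T z))))"
proof (cases "real M \<le> sqrt (real n)")
  case True
  then have H: "H = Lambda M" and \<psi>: "\<psi> = real M / real n"
    using assms by (auto simp: aggregation_C_def)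
  have "2 \<le> n" using M by simp
  then obtain r where r: "2 ^ r \<le> n" "n < 2 ^ Suc r" using ex_power2_ivl by blast
  have "(real M)\<^sup>2 \<le> (sqrt (real n))\<^sup>2" using True by (intro power_mono) auto
  then have "real (M\<^sup>2) \<le> real n" by simp
  then have "M\<^sup>2 \<le> n" by (simp only: of_nat_le_iff)
  moreover have "(2 * (M div 2))\<^sup>2 \<le> M\<^sup>2" by (intro power_mono) auto
  ultimately have "(M div 2)\<^sup>2 \<le> 2 ^ r" using r(2) by (simp add: power_mult_distrib)
  moreover have "M \<le> 3 * (M div 2)" using M by linarith
  ultimately show ?thesis
    unfolding H using M r by (intro minimax_risk_ge_walsh[where D = "M div 2" and m = 1]) (auto simp: \<psi>)
next
  case False
  define x where "x = 1 + real M / sqrt (real n)"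
  have H: "H = Lambda M" and \<psi>: "\<psi> = sqrt (ln x / real n)"
    using assms False by (auto simp: aggregation_C_def x_def)
  have n: "0 < real n" "1 < sqrt (real n)" using M by auto
  have "1 < real M / sqrt (real n)" using False n by (simp add: field_simps)
  moreover have "real M / sqrt (real n) < real M" using n M by (simp add: field_simps)
  \<comment> \<open>The bounds serve, in order, to get \<open>m\<close> positive,
    \<open>2 ^ m \<le> M\<close>, and room for \<open>D\<close> groups in the dictionary.\<close>
  ultimately have x: "2 < x" "x < 1 + real M" "x \<le> 2 * real M / sqrt (real n)"
    by (simp_all add: x_def)
  have "2 \<le> nat \<lfloor>x\<rfloor>" using x(1) by linarith
  then obtain m where m: "0 < m" "m < 2 ^ m" "2 ^ m \<le> nat \<lfloor>x\<rfloor>" "nat \<lfloor>x\<rfloor> < 2 ^ Suc m"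
    using ex_power2_ivl by blast
  have "real (2 ^ m) \<le> real (nat \<lfloor>x\<rfloor>)" using m(3) by (simp only: of_nat_le_iff)
  also have "\<dots> \<le> x" using x(1) by simp
  finally have m_le: "2 ^ m \<le> x" by simp
  then have "real (2 ^ m) < real (1 + M)" using x(2) by simp
  then have mM: "2 ^ m \<le> M" by (simp only: of_nat_less_iff)
  have "x \<le> real (nat \<lfloor>x\<rfloor> + 1)" using x(1) by linarith
  also have "\<dots> \<le> real (2 ^ Suc m)" using m(4) by (simp only: of_nat_le_iff)
  finally have "x \<le> 2 ^ Suc m" by simp
  then have "ln x \<le> real (Suc m)" using x(1) by (intro ln_le_of_le_power2) auto
  then have lnx: "ln x \<le> 2 * real m" using m(1) by simp
  have "m \<le> n" using m(2) mM M by linarith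
  then have "1 \<le> n div m" using m(1) by (simp add: less_eq_div_iff_mult_less_eq)
  \<comment> \<open>\<open>2 ^ r\<close> is the largest power of two for which \<open>m\<close>
    blocks of this length fit into \<open>n\<close> points.\<close>
  then obtain r where r: "2 ^ r \<le> n div m" "n div m < 2 ^ Suc r"
    using ex_power_ivl1[of 2 "n div m"] by auto
  have points: "m * 2 ^ r \<le> n"
    using r(1) m(1) by (simp add: less_eq_div_iff_mult_less_eq mult.commute)
  have "n < m * 2 ^ Suc r"
    using r(2) m(1) by (simp add: div_less_iff_less_mult mult.commute)
  then have "real n \<le> real (m * 2 ^ Suc r)" by (simp only: of_nat_le_iff)
  then have nm: "real n / real m \<le> 2 * 2 ^ r" using m(1) by (simp add: field_simps)
  \<comment> \<open>The divisor 2 cancels the factor 2 in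
    \<open>x \<le> 2 * real M / sqrt (real n)\<close> when the dictionary size is checked.\<close>
  define s where "s = sqrt (real n / real m) / 2"
  have s0: "0 \<le> s" by (simp add: s_def)
  \<comment> \<open>The maximum covers \<open>s < 1\<close>, where the floor would be 0; the
    constraints are then checked directly for \<open>D = 1\<close>.\<close>
  define D where "D = max 1 (nat \<lfloor>s\<rfloor>)"
  have D: "0 < D" "s \<le> 2 * real D" unfolding D_def by linarith+
  have Ds: "D = 1 \<or> real D \<le> s" using s0 unfolding D_def by linarith
  have "s\<^sup>2 = real n / real m / 4" by (simp add: s_def power_divide)
  also have "\<dots> \<le> 2 * 2 ^ r / 4" using nm by (rule divide_right_mono) simp
  also have "\<dots> \<le> 2 ^ r" by simp
  finally have "s\<^sup>2 \<le> 2 ^ r" .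
  have "(real D)\<^sup>2 \<le> 2 ^ r"
  proof (cases "D = 1")
    case False
    then have "(real D)\<^sup>2 \<le> s\<^sup>2" using Ds by (intro power_mono) auto
    with \<open>s\<^sup>2 \<le> 2 ^ r\<close> show ?thesis by (rule order_trans[rotated])
  qed simp
  then have "real (D\<^sup>2) \<le> real (2 ^ r)" by simp
  then have D2: "D\<^sup>2 \<le> 2 ^ r" by (simp only: of_nat_le_iff)
  have dict: "D * 2 ^ m \<le> M"
  proof (cases "D = 1")
    case True
    then show ?thesis using mM by simp
  next
    case False
    have "sqrt (real n / real m) \<le> sqrt (real n)"
      using divide_left_mono[of 1 "real m" "real n"] m(1) by (intro real_sqrt_le_mono) simp
    then have "s \<le> sqrt (real n) / 2" unfolding s_def by (rule divide_right_mono) simp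
    then have "real D \<le> sqrt (real n) / 2" using Ds False by linarith
    then have "real D * 2 ^ m \<le> sqrt (real n) / 2 * (2 * real M / sqrt (real n))"
      using m_le x(3) by (intro mult_mono) auto
    also have "\<dots> = real M" using n by simp
    finally have "real (D * 2 ^ m) \<le> real M" by simp
    then show ?thesis by (simp only: of_nat_le_iff)
  qed
  have "real n * \<psi> = sqrt ((real n)\<^sup>2 * (ln x / real n))"
    by (simp only: \<psi> real_sqrt_mult real_sqrt_abs abs_of_nat)
  also have "(real n)\<^sup>2 * (ln x / real n) = real n * ln x"
    using n by (simp add: power2_eq_square)
  also have "sqrt (real n * ln x) \<le> sqrt (real n * (2 * real m))" using lnx by (intro real_sqrt_le_mono mult_left_mono) auto
  also have "\<dots> \<le> 12 * real (D * m)"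
  proof (rule real_le_lsqrt)
    \<comment> \<open>Here \<open>s\<^sup>2 = n / (4 * m)\<close>; then \<open>s \<le> 2 * D\<close>
      gives \<open>32 * (D * m)\<^sup>2\<close>, below the square of
      \<open>12 * D * m\<close>.\<close>
    have "real n * (2 * real m) = 8 * (s * real m)\<^sup>2"
      using m(1) by (simp add: s_def power_mult_distrib power_divide field_simps power2_eq_square)
    also have "\<dots> \<le> 8 * (2 * real D * real m)\<^sup>2"
      using D s0 by (intro mult_left_mono power_mono mult_right_mono) auto
    also have "\<dots> \<le> (12 * real (D * m))\<^sup>2" by (simp add: power_mult_distrib)
    finally show "real n * (2 * real m) \<le> (12 * real (D * m))\<^sup>2" .
  qed auto
  finally have "real n * \<psi> \<le> 12 * real (D * m)" .
  moreover have "0 < \<psi>" using n x by (simp add: \<psi>)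
  ultimately show ?thesis
    unfolding H using D(1) m(1) points dict D2 by (intro minimax_risk_ge_walsh) 
qed

end

theorem theorem5p1:
  fixes \<X> :: "(real ^ 'd) set" and \<sigma> L :: real and w :: "real \<Rightarrow> real"
  assumes "\<X> \<in> sets borel" and "0 < \<sigma>" and "0 < L"
    and "loss_function w"
    and w_pos: "\<And>t. 0 < t \<Longrightarrow> 0 < w t"
  shows "\<exists>c>0. \<forall>(n::nat) (M::nat) (D::nat) (X :: nat \<Rightarrow> real ^ 'd) H \<psi>.
    2 \<le> M \<and> M \<le> n \<and> X ` {1..n} \<subseteq> \<X> \<and> inj_on X {1..n} \<and>
    (aggregation_C n M H \<psi> \<or> aggregation_MS n M H \<psi> \<or> aggregation_S n M D H \<psi>)
    \<longrightarrow> (\<exists>fs. (\<forall>j\<in>{1..M}. fs j \<in> F0 \<X> L) \<and>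
          (INF T\<in>estimators n \<X>. SUP f\<in>F0 \<X> L.
             expect n \<sigma> X f (\<lambda>z. w (inverse \<psi> * excess n M X H fs f (T z)))) \<ge> ennreal c)"
proof -
  \<comment> \<open>The bound by \<sigma> keeps neighbouring vertices hard to distinguish; the bound
    by \<open>L\<close> keeps the dictionary and the cube in \<open>F0\<close>. Thus
    \<open>c\<close> depends only on \<sigma>, \<open>L\<close> and \<open>w\<close>.\<close>
  define a where "a = min L \<sigma>"
  have a: "0 < a" "a \<le> \<sigma>" "a \<le> L" using assms by (auto simp: a_def)
  have "0 < w (a\<^sup>2 / 384) / 32" using a by (simp add: w_pos)
  then show ?thesis
  proof (intro exI[of _ "w (a\<^sup>2 / 384) / 32"] conjI allI impI; (elim conjE)?)
    fix n M D :: nat and X :: "nat \<Rightarrow> real ^ 'd" and H \<psi>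
    assume X: "2 \<le> M" "M \<le> n" "X ` {1..n} \<subseteq> \<X>" "inj_on X {1..n}"
    assume "aggregation_C n M H \<psi> \<or> aggregation_MS n M H \<psi> \<or> aggregation_S n M D H \<psi>"
    then show "\<exists>fs. (\<forall>j\<in>{1..M}. fs j \<in> F0 \<X> L) \<and>
      ennreal (w (a\<^sup>2 / 384) / 32) \<le> (INF T\<in>estimators n \<X>. SUP f\<in>F0 \<X> L.
        expect n \<sigma> X f (\<lambda>z. w (inverse \<psi> * excess n M X H fs f (T z))))"
      by (elim disjE)
        (rule minimax_risk_ge_C[OF \<open>0 < \<sigma>\<close> a \<open>loss_function w\<close> X(3,4,1,2)]
          minimax_risk_ge_MS[OF \<open>0 < \<sigma>\<close> a \<open>loss_function w\<close> X(3,4,1,2)]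
          minimax_risk_ge_S[OF \<open>0 < \<sigma>\<close> a \<open>loss_function w\<close> X(3,4,1,2)]; assumption)+
  qed
qed

end
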